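(* Let $1<p<\infty$, and let $T$ be a monotone quasilinear operator on $\mathfrak{M}^+(0,\infty)$. Assume that $w\in\mathcal{W}(0,\infty)$ and that $v\in\mathcal{W}(0,\infty)$ is such that $$\int_x^\infty v^{1-p'}(t)\,dt<\infty,\qquad x\in(0,\infty).$$ Then the inequality $$\left\| T\left(\int_x^{\infty} h\right)\right\|_{\infty,w,(0,\infty)}\le C\,\|h\|_{p,v,(0,\infty)},\qquad h\in\mathfrak{M}^+(0,\infty),$$ holds if and only if the inequality $$\left\|\left(T\left(\left(\int_x^{\infty} h\right)^{\frac1p}\right)\right)^p\right\|_{\infty,w^p,(0,\infty)}\le C^p\,\|h\|_{1,\Psi^{1-2p},(0,\infty)},\qquad h\in\mathfrak{M}^+(0,\infty),$$ holds, where $$\Psi(x)=\left(\int_x^\infty v^{1-p'}(t)\,dt\right)^{\frac{1}{p'+1}},\qquad x\in(0,\infty).$$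
   Context: $\mathfrak{M}(0,\infty)$ is the set of measurable functions on $(0,\infty)$; $\mathfrak{M}^+(0,\infty)$ is the subset of functions non-negative on $(0,\infty)$; $\mathcal{W}(0,\infty)$ is the set of weights, i.e. measurable functions that are positive almost everywhere on $(0,\infty)$. For $p\in(1,\infty)$, $p'=p/(p-1)$. For $\omega\in\mathfrak{M}^+(0,\infty)$: $\|f\|_{s,\omega,(0,\infty)}=\left(\int_0^\infty |f(x)|^s\omega(x)\,dx\right)^{1/s}$ if $s\in(0,\infty)$, and $\|f\|_{\infty,\omega,(0,\infty)}=\operatorname{ess\,sup}_{x\in(0,\infty)}|f(x)|\,\omega(x)$. A monotone quasilinear operator on $\mathfrak{M}^+(0,\infty)$ is a map $T:\mathfrak{M}^+(0,\infty)\to\mathfrak{M}^+(0,\infty)$ such that: (i) $T(\lambda f)=\lambda Tf$ for all $\lambda\ge0$ and $f\in\mathfrak{M}^+(0,\infty)$; (ii) there is a constant $c>0$, independent of $f,g$, such that $Tf(x)\le c\,Tg(x)$ for almost all $x$ whenever $f(x)\le g(x)$ for almost all $x$; (iii) there is a constant $c>0$, independent of $f,g$, such that $T(f+g)\le c\,(Tf+Tg)$ for all $f,g\in\mathfrak{M}^+(0,\infty)$. In expressions such as $T\left(\int_x^\infty h\right)$ the operator $T$ acts on the function $x\mapsto\int_x^\infty h(t)\,dt$, and $T\left(\left(\int_x^\infty h\right)^{1/p}\right)$ is $T$ applied to $x\mapsto\left(\int_x^\infty h(t)\,dt\right)^{1/p}$. An inequality "holds" if there is a constant $C>0$, independent of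 $h$, for which it is valid for all indicated $h$; the constant $C$ may vary from one inequality to another. Conventions: $0\cdot\infty=0$, $\infty/\infty=0$, $0/0=0$. *)

theory Defs
  imports "HOL-Probability.Essential_Supremum"
begin

text \<open>
  Functions in the class of non-negative measurable functions on the half-line may take the value
  infinity (an integral over a tail need not be finite), so they are modelled as functions into
  \<^typ>\<open>ennreal\<close>. Arithmetic on \<^typ>\<open>ennreal\<close> satisfies the conventions
  \<open>0 * \<infinity> = 0\<close>, \<open>\<infinity> / \<infinity> = 0\<close> and \<open>0 / 0 = 0\<close>.
  The domain type is \<^typ>\<open>real\<close>; values outside \<open>{0<..}\<close> are never constrained.
\<close>

definition Mplus :: "(real \<Rightarrow> ennreal) set" where
  "Mplus = borel_measurable (lebesgue_on {0<..})"

text \<open>Weights occur only under integrals and essential suprema, and as densities in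
  \<^term>\<open>Mplus\<close>; they may be infinite, even on a set of positive measure.\<close>

definition weights :: "(real \<Rightarrow> ennreal) set" where
  "weights = {w \<in> Mplus. AE x in lebesgue_on {0<..}. 0 < w x}"

definition conj_exp :: "real \<Rightarrow> real" where
  "conj_exp p = p / (p - 1)"

text \<open>Real powers on \<open>[0, \<infinity>]\<close>, with \<open>a\<^sup>0 = 1\<close>, and with the values
  \<open>0\<^sup>r = \<infinity>\<close> and \<open>\<infinity>\<^sup>r = 0\<close> for negative exponents.\<close>

definition epow :: "ennreal \<Rightarrow> real \<Rightarrow> ennreal" where
  "epow a r =
     (if r = 0 then 1
      else if a = \<infinity> then (if 0 < r then \<infinity> else 0)
      else if a = 0 then (if 0 < r then 0 else \<infinity>)
      else ennreal (enn2real a powr r))"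

text \<open>The weighted norms for a finite exponent and for the exponent infinity. All functions
  are non-negative here, so no absolute value is needed.\<close>

definition wnorm :: "real \<Rightarrow> (real \<Rightarrow> ennreal) \<Rightarrow> (real \<Rightarrow> ennreal) \<Rightarrow> ennreal" where
  "wnorm s \<omega> f = epow (\<integral>\<^sup>+x\<in>{0<..}. epow (f x) s * \<omega> x \<partial>lebesgue) (1 / s)"

definition wnorm_inf :: "(real \<Rightarrow> ennreal) \<Rightarrow> (real \<Rightarrow> ennreal) \<Rightarrow> ennreal" where
  "wnorm_inf \<omega> f = esssup (lebesgue_on {0<..}) (\<lambda>x. f x * \<omega> x)"

text \<open>Homogeneity and quasi-subadditivity are required only almost everywhere, as the
  monotonicity condition is; this admits every operator for which they hold pointwise on
  \<open>{0<..}\<close>. By the monotonicity condition, the values of \<open>f\<close> outside \<open>{0<..}\<close>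
  affect \<open>T f\<close> on \<open>{0<..}\<close> at most up to a constant factor and a null set.\<close>

definition monotone_quasilinear :: "((real \<Rightarrow> ennreal) \<Rightarrow> (real \<Rightarrow> ennreal)) \<Rightarrow> bool" where
  "monotone_quasilinear T \<longleftrightarrow>
     (\<forall>f\<in>Mplus. T f \<in> Mplus) \<and>
     (\<forall>l\<ge>0. \<forall>f\<in>Mplus.
        AE x in lebesgue_on {0<..}. T (\<lambda>y. ennreal l * f y) x = ennreal l * T f x) \<and>
     (\<exists>c>0. \<forall>f\<in>Mplus. \<forall>g\<in>Mplus.
        (AE x in lebesgue_on {0<..}. f x \<le> g x) \<longrightarrow>
        (AE x in lebesgue_on {0<..}. T f x \<le> ennreal c * T g x)) \<and>
     (\<exists>c>0. \<forall>f\<in>Mplus. \<forall>g\<in>Mplus.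
        AE x in lebesgue_on {0<..}. T (\<lambda>y. f y + g y) x \<le> ennreal c * (T f x + T g x))"

definition Psi :: "real \<Rightarrow> (real \<Rightarrow> ennreal) \<Rightarrow> real \<Rightarrow> ennreal" where
  "Psi p v x = epow (\<integral>\<^sup>+t\<in>{x<..}. epow (v t) (1 - conj_exp p) \<partial>lebesgue)
                    (1 / (conj_exp p + 1))"

end

theory Submission
  imports Defs "HOL-Probability.Distribution_Functions"
begin

text \<open>
  Let \<open>q\<close> be the conjugate exponent of \<open>p\<close>, let \<open>u = v\<^sup>1\<^sup>-\<^sup>q\<close> and \<open>V(x) = \<integral>\<^sub>x\<^sup>\<infinity> u\<close>. The
  exponents are such that \<open>\<Psi>\<^sup>1\<^sup>-\<^sup>2\<^sup>p = V\<^sup>1\<^sup>-\<^sup>p\<close>, so after taking \<open>p\<close>-th roots both inequalities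
  bound \<open>\<parallel>T f\<parallel>\<close> in the same weighted \<open>L\<^sup>\<infinity>\<close> space, and only the cost of the decreasing function
  \<open>f\<close> differs: the first prices \<open>f = \<integral>\<^sub>x\<^sup>\<infinity> h\<close> at \<open>(\<integral> h\<^sup>p v)\<^sup>1\<^sup>/\<^sup>p\<close>, the second prices
  \<open>f = (\<integral>\<^sub>x\<^sup>\<infinity> h)\<^sup>1\<^sup>/\<^sup>p\<close> at \<open>(\<integral> h V\<^sup>1\<^sup>-\<^sup>p)\<^sup>1\<^sup>/\<^sup>p\<close>. As \<open>T\<close> is monotone and homogeneous, it suffices that
  every function of one kind lies below a function of the other kind of comparable cost.

  Writing \<open>h = r u\<close> turns \<open>\<integral> h\<^sup>p v\<close> into \<open>\<integral> r\<^sup>p d\<mu>\<close> for the measure \<open>\<mu> = u dx\<close>, which has no atoms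
  and has tails \<open>V\<close>. Thus \<open>v\<close> disappears, and both comparisons concern \<open>\<mu>\<close> alone.

  From the second inequality to the first (\<open>hardy_majorant\<close>): Hoelder's inequality with the weight
  \<open>V\<^sup>-\<^sup>1\<^sup>/\<^sup>2\<close> bounds \<open>(\<integral>\<^sub>x\<^sup>\<infinity> r d\<mu>)\<^sup>p\<close> by a constant times \<open>V(x)\<^sup>d \<integral>\<^sub>x\<^sup>\<infinity> r\<^sup>p V\<^sup>d d\<mu>\<close> with
  \<open>d = (p - 1)/2\<close>. By the product rule this decreasing function is a tail integral \<open>\<integral>\<^sub>x\<^sup>\<infinity> H d\<mu>\<close>,
  and Fubini gives \<open>\<integral> H V\<^sup>1\<^sup>-\<^sup>p d\<mu> \<le> 2 \<integral> r\<^sup>p d\<mu>\<close>.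

  From the first inequality to the second (\<open>tail_power_majorant\<close>): put
  \<open>A(t) = (\<integral>\<^sub>0\<^sup>t h V\<^sup>-\<^sup>p dx)\<^sup>1\<^sup>/\<^sup>p\<close>. Fubini gives \<open>\<integral> A\<^sup>p d\<mu> \<le> \<integral> h V\<^sup>1\<^sup>-\<^sup>p dx\<close>; and as \<open>A\<close> increases,
  \<open>A(t) V(t)\<close> is at most \<open>\<integral>\<^sub>t\<^sup>\<infinity> A d\<mu>\<close>, from which
  \<open>\<integral>\<^sub>x\<^sup>\<infinity> h dx \<le> p (\<integral>\<^sub>x\<^sup>\<infinity> A d\<mu>)\<^sup>p\<close> follows.

  Both arguments rest on the fact that \<open>V\<close> carries \<open>\<mu>\<close> on \<open>(x, \<infinity>)\<close> to Lebesgue measure on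
  \<open>(0, V(x))\<close> (\<open>nn_integral_survival_transform\<close>), so that powers of \<open>V\<close> integrate against \<open>\<mu>\<close> like
  powers of the identity.
\<close>

section \<open>Real powers of extended non-negative numbers\<close>

lemma epow_top [simp]: "0 < r \<Longrightarrow> epow \<infinity> r = \<infinity>" "0 < r \<Longrightarrow> epow top r = top"
  by (simp_all add: epow_def)

lemma epow_zero [simp]: "0 < r \<Longrightarrow> epow 0 r = 0"
  by (simp add: epow_def)

lemma epow_1_right [simp]: "epow a 1 = a"
  by (cases a) (auto simp: epow_def powr_one)

lemma epow_ennreal: "0 < x \<Longrightarrow> epow (ennreal x) r = ennreal (x powr r)"
  by (simp add: epow_def)

lemma epow_ennreal': "0 \<le> x \<Longrightarrow> 0 < r \<Longrightarrow> epow (ennreal x) r = ennreal (x powr r)"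
  by (cases "x = 0") (simp_all add: epow_ennreal)

lemma ennreal_zero_pos_top_cases:
  fixes a :: ennreal
  obtains "a = 0" | x where "0 < x" "a = ennreal x" | "a = top"
proof (cases a)
  case (real x)
  then show ?thesis using that(1,2) by (cases "x = 0") auto
qed (use that(3) in auto)

lemma measurable_epow [measurable]: "(\<lambda>a. epow a r) \<in> borel_measurable borel"
  unfolding epow_def by measurable

lemma measurable_epow_comp [measurable (raw)]:
  "f \<in> borel_measurable M \<Longrightarrow> (\<lambda>x. epow (f x) r) \<in> borel_measurable M"
  using measurable_compose[OF _ measurable_epow] .

lemma epow_mono: "0 \<le> r \<Longrightarrow> a \<le> b \<Longrightarrow> epow a r \<le> epow b r"
  by (cases a rule: ennreal_zero_pos_top_cases; cases b rule: ennreal_zero_pos_top_cases)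
     (auto simp: epow_def top_unique intro!: ennreal_leI powr_mono2)

lemma epow_mult: "0 < r \<Longrightarrow> epow (a * b) r = epow a r * epow b r"
  by (cases a rule: ennreal_zero_pos_top_cases; cases b rule: ennreal_zero_pos_top_cases)
     (auto simp: ennreal_mult_top ennreal_top_mult epow_ennreal powr_mult simp flip: ennreal_mult)

lemma epow_epow: "epow (epow a r) s = epow a (r * s)"
  by (cases a rule: ennreal_zero_pos_top_cases)
     (auto simp: epow_def powr_powr zero_less_mult_iff mult_less_0_iff)

lemma epow_inverse: "0 < r \<Longrightarrow> epow (epow a r) (1 / r) = a"  "0 < r \<Longrightarrow> epow (epow a (1 / r)) r = a"
  by (simp_all add: epow_epow)

lemma epow_add: "0 < r \<Longrightarrow> 0 < s \<Longrightarrow> epow a (r + s) = epow a r * epow a s"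
  by (cases a rule: ennreal_zero_pos_top_cases)
     (auto simp: epow_def powr_add ennreal_mult)

text \<open>For exponents of opposite sign the law of exponents fails at \<open>0\<close> and \<open>\<infinity>\<close>, where one factor is
  \<open>0\<close> and the other \<open>\<infinity>\<close>.\<close>

lemma epow_add_fin: "a \<noteq> 0 \<Longrightarrow> a \<noteq> top \<Longrightarrow> epow a (r + s) = epow a r * epow a s"
  by (cases a rule: ennreal_zero_pos_top_cases)
     (auto simp: epow_ennreal powr_add simp flip: ennreal_mult)

lemma epow_le_iff: "0 < r \<Longrightarrow> epow a r \<le> epow b r \<longleftrightarrow> a \<le> b"
  by (metis epow_inverse(1) epow_mono less_eq_real_def zero_less_divide_1_iff)

lemma nn_integral_powr_Ioo:
  assumes "0 < \<gamma>" "0 \<le> b"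
  shows "(\<integral>\<^sup>+s\<in>{0<..<b}. ennreal \<gamma> * epow (ennreal s) (\<gamma> - 1) \<partial>lborel) = epow (ennreal b) \<gamma>"
proof -
  have "((\<lambda>s. s powr (\<gamma> - 1)) has_integral (b powr \<gamma> / \<gamma>)) {0..b}"
    using has_integral_powr_from_0[of "\<gamma> - 1" b] assms by simp
  from has_integral_mult_right[OF this, of \<gamma>]
  have I: "((\<lambda>s. \<gamma> * s powr (\<gamma> - 1)) has_integral b powr \<gamma>) {0..b}"
    using assms by simp
  have "(\<integral>\<^sup>+s. ennreal (indicator {0..b} s * (\<gamma> * s powr (\<gamma> - 1))) \<partial>lborel) = ennreal (b powr \<gamma>)"
    using I assms by (intro nn_integral_has_integral_lebesgue) auto
  moreover have "(\<integral>\<^sup>+s\<in>{0<..<b}. ennreal \<gamma> * epow (ennreal s) (\<gamma> - 1) \<partial>lborel)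
      = (\<integral>\<^sup>+s. ennreal (indicator {0..b} s * (\<gamma> * s powr (\<gamma> - 1))) \<partial>lborel)"
  proof (rule nn_integral_cong_AE)
    have "AE s in lborel. s \<noteq> b" by (rule AE_lborel_singleton)
    then show "AE s in lborel. ennreal \<gamma> * epow (ennreal s) (\<gamma> - 1) * indicator {0<..<b} s
        = ennreal (indicator {0..b} s * (\<gamma> * s powr (\<gamma> - 1)))"
      by eventually_elim
        (use assms in \<open>auto simp: epow_ennreal ennreal_mult indicator_def\<close>)
  qed
  ultimately show ?thesis using assms by (simp add: epow_ennreal')
qed

lemma nn_integral_powr_atLeast:
  assumes "0 < \<delta>" "0 < a"
  shows "(\<integral>\<^sup>+s\<in>{a..}. ennreal \<delta> * epow (ennreal s) (- \<delta> - 1) \<partial>lborel) = epow (ennreal a) (- \<delta>)"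
proof -
  have "((\<lambda>s. s powr (- \<delta> - 1)) has_integral - (a powr (- \<delta>)) / (- \<delta>)) {a..}"
    using has_integral_powr_to_inf[of "- \<delta> - 1" a] assms by simp
  from has_integral_mult_right[OF this, of \<delta>]
  have I: "((\<lambda>s. \<delta> * s powr (- \<delta> - 1)) has_integral a powr (- \<delta>)) {a..}"
    using assms by simp
  have "(\<integral>\<^sup>+s. ennreal (indicator {a..} s * (\<delta> * s powr (- \<delta> - 1))) \<partial>lborel) = ennreal (a powr (- \<delta>))"
    using I assms by (intro nn_integral_has_integral_lebesgue) auto
  moreover have "(\<integral>\<^sup>+s\<in>{a..}. ennreal \<delta> * epow (ennreal s) (- \<delta> - 1) \<partial>lborel)
      = (\<integral>\<^sup>+s. ennreal (indicator {a..} s * (\<delta> * s powr (- \<delta> - 1))) \<partial>lborel)"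
    by (intro nn_integral_cong)
       (use assms in \<open>auto simp: epow_ennreal ennreal_mult indicator_def\<close>)
  ultimately show ?thesis using assms by (simp add: epow_ennreal)
qed

section \<open>The tail of an atomless measure as a change of variables\<close>

text \<open>This is the probability integral transform: the survival function \<open>S\<close> of an atomless
  distribution of mass \<open>b\<close> is uniformly distributed on \<open>(0, b)\<close>. Without atoms \<open>S\<close> is continuous,
  hence takes each value \<open>l\<close> in \<open>(0, b)\<close>, say at \<open>y\<close>; the ray beyond \<open>y\<close> then lies between
  \<open>{S < l}\<close> and \<open>{S \<le> l}\<close> and has mass \<open>l\<close>. This fixes the distribution function of the
  image measure.\<close>

lemma (in finite_borel_measure) nn_integral_survival_transform:
  assumes atomless: "\<And>x. measure M {x} = 0"
    and [measurable]: "\<phi> \<in> borel_measurable borel"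
  shows "(\<integral>\<^sup>+t. \<phi> (measure M {t<..}) \<partial>M) = (\<integral>\<^sup>+s\<in>{0<..<measure M UNIV}. \<phi> s \<partial>lborel)"
proof -
  define b where "b = measure M UNIV"
  define S where "S = (\<lambda>t. measure M {t<..})"
  have sp [simp]: "space M = UNIV" by (rule borel_UNIV)
  have [measurable_cong]: "sets M = sets borel" by (rule M_is_borel)
  have S_cdf: "S t = b - cdf M t" for t
  proof -
    have "measure M (UNIV - {..t}) = b - cdf M t"
      unfolding b_def cdf_def by (subst finite_measure_Diff) (auto simp: M_is_borel)
    also have "UNIV - {..t} = {t<..}" by auto
    finally show ?thesis by (simp add: S_def)
  qed
  have S_anti: "S y \<le> S x" if "x \<le> y" for x y
    using cdf_nondecreasing[OF that] by (simp add: S_cdf)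
  have S_nonneg: "0 \<le> S x" for x by (simp add: S_def)
  have S_le: "S x \<le> b" for x using cdf_nonneg[of x] by (simp add: S_cdf)
  have b_nonneg: "0 \<le> b" by (simp add: b_def)
  have [measurable]: "cdf M \<in> borel_measurable borel"
    by (intro borel_measurable_mono) (auto simp: mono_def cdf_nondecreasing)
  have S_meas [measurable]: "S \<in> borel_measurable borel"
  proof -
    have "S = (\<lambda>t. b - cdf M t)" by (rule ext) (rule S_cdf)
    then show ?thesis by simp
  qed
  have ex: "\<exists>y. S y = l" if "0 < l" "l < b" for l
  proof -
    have "\<forall>\<^sub>F x in at_bot. cdf M x < b - l"
      using cdf_lim_at_bot that by (intro order_tendstoD) auto
    then obtain x where x: "cdf M x < b - l"
      by (auto simp: eventually_at_bot_linorder)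
    have "\<forall>\<^sub>F x in at_top. b - l < cdf M x"
      using cdf_lim_at_top that by (intro order_tendstoD) (auto simp: b_def)
    then obtain z where z: "b - l < cdf M z"
      by (auto simp: eventually_at_top_linorder)
    have "x \<le> z" using x z cdf_nondecreasing[of z x] by linarith
    moreover have "continuous_on {x..z} (cdf M)"
      using atomless isCont_cdf by (intro continuous_at_imp_continuous_on) auto
    ultimately obtain y where "cdf M y = b - l"
      using IVT'[of "cdf M" x "b - l" z] x z by auto
    then show ?thesis by (intro exI[of _ y]) (simp add: S_cdf)
  qed
  have upper: "measure M {t. S t < l} \<le> l" if l: "0 < l" for l
  proof (cases "l < b")
    case True
    then obtain y where y: "S y = l" using ex[of l] l True by auto
    have "y < t" if "S t < l" for t
      using S_anti[of t y] y that by (cases "y < t") auto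
    then have "{t. S t < l} \<subseteq> {y<..}" by auto
    then have "measure M {t. S t < l} \<le> S y"
      unfolding S_def by (intro finite_measure_mono) auto
    with y show ?thesis by simp
  next
    case False
    then show ?thesis using bounded_measure[of "{t. S t < l}"] by (simp add: b_def)
  qed
  have lower: "l \<le> measure M {t. S t \<le> l}" if l: "0 < l" "l < b" for l
  proof -
    obtain y where y: "S y = l" using ex[of l] l by auto
    have "{y<..} \<subseteq> {t. S t \<le> l}" using S_anti y by force
    then have "S y \<le> measure M {t. S t \<le> l}"
      unfolding fun_cong[OF S_def, of y] by (intro finite_measure_mono) auto
    with y show ?thesis by simp
  qed
  have dist: "measure M {t. S t \<le> l} = max 0 (min l b)" for l
  proof -
    consider "l < 0" | "0 \<le> l" "l < b" | "b \<le> l" "0 \<le> l" by linarith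
    then show ?thesis
    proof cases
      case 1
      then have "\<not> S t \<le> l" for t using S_nonneg[of t] by linarith
      then have "{t. S t \<le> l} = {}" by simp
      with 1 show ?thesis using b_nonneg by simp
    next
      case 2
      have "measure M {t. S t \<le> l} \<le> l + e" if "0 < e" for e
      proof -
        have "measure M {t. S t \<le> l} \<le> measure M {t. S t < l + e}"
          using that by (intro finite_measure_mono) auto
        with upper[of "l + e"] that 2 show ?thesis by simp
      qed
      then have "measure M {t. S t \<le> l} \<le> l" by (rule field_le_epsilon)
      moreover have "l \<le> measure M {t. S t \<le> l}"
        using lower[of l] 2 by (cases "l = 0") auto
      ultimately show ?thesis using 2 by simp
    next
      case 3
      then have "S t \<le> l" for t using S_le[of t] by linarith
      then have "{t. S t \<le> l} = UNIV" by simp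
      with 3 show ?thesis using b_nonneg by (simp add: b_def)
    qed
  qed
  define D where "D = distr M borel S"
  define U where "U = density lborel (indicator {0<..<b})"
  have em_U: "emeasure U A = emeasure lborel ({0<..<b} \<inter> A)" if "A \<in> sets borel" for A
    using that by (simp add: U_def emeasure_restricted)
  have "finite_borel_measure D"
    unfolding D_def by (intro finite_borel_measure.intro finite_measure_distr) (auto intro!: finite_borel_measure_axioms.intro)
  moreover have "finite_borel_measure U"
  proof (intro finite_borel_measure.intro finite_borel_measure_axioms.intro finite_measureI)
    have "space U = UNIV" by (simp add: U_def)
    then have "emeasure U (space U) = ennreal b" using em_U[of UNIV] b_nonneg by simp
    then show "emeasure U (space U) \<noteq> \<infinity>" by simp
    show "sets U = sets borel" by (simp add: U_def)
  qed
  moreover have "cdf D = cdf U"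
  proof
    fix l
    have "cdf D l = measure M {t. S t \<le> l}"
      unfolding cdf_def D_def by (subst measure_distr) (auto intro!: arg_cong[where f="measure M"])
    moreover have "cdf U l = max 0 (min l b)"
    proof -
      have "measure U {..l} = measure lborel ({0<..<b} \<inter> {..l})"
        by (simp add: measure_def em_U)
      also have "{0<..<b} \<inter> {..l} = (if l < b then {0<..l} else {0<..<b})" by auto
      finally show ?thesis using b_nonneg by (auto simp: cdf_def max_def min_def)
    qed
    ultimately show "cdf D l = cdf U l" by (simp add: dist)
  qed
  ultimately have "D = U" by (rule cdf_unique')
  have "(\<integral>\<^sup>+t. \<phi> (S t) \<partial>M) = (\<integral>\<^sup>+s. \<phi> s \<partial>D)"
    unfolding D_def by (subst nn_integral_distr) auto
  also have "\<dots> = (\<integral>\<^sup>+s. \<phi> s * indicator {0<..<b} s \<partial>lborel)"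
    unfolding \<open>D = U\<close> U_def by (subst nn_integral_density) (auto simp: mult.commute)
  finally show ?thesis by (simp add: S_def b_def)
qed

section \<open>Integrals of extended non-negative functions\<close>

lemma nn_integral_triangle_swap:
  fixes M N :: "real measure"
  assumes "sigma_finite_measure M" "sigma_finite_measure N"
    and [measurable]: "(\<lambda>t. t) \<in> borel_measurable M" "(\<lambda>t. t) \<in> borel_measurable N"
    and [measurable]: "f \<in> borel_measurable M" "g \<in> borel_measurable N"
  shows "(\<integral>\<^sup>+y. g y * (\<integral>\<^sup>+t\<in>{..y}. f t \<partial>M) \<partial>N) = (\<integral>\<^sup>+t. f t * (\<integral>\<^sup>+y\<in>{t..}. g y \<partial>N) \<partial>M)"
proof -
  interpret M: sigma_finite_measure M by fact
  interpret N: sigma_finite_measure N by fact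
  interpret pair_sigma_finite M N ..
  have [measurable]: "fst \<in> borel_measurable (M \<Otimes>\<^sub>M N)" "snd \<in> borel_measurable (M \<Otimes>\<^sub>M N)"
    using measurable_compose[OF measurable_fst assms(3)] measurable_compose[OF measurable_snd assms(4)]
    by (auto simp: comp_def)
  define F where "F = (\<lambda>t y. if t \<le> y then f t * g y else 0)"
  have [measurable]: "(\<lambda>z. f (fst z)) \<in> borel_measurable (M \<Otimes>\<^sub>M N)" "(\<lambda>z. g (snd z)) \<in> borel_measurable (M \<Otimes>\<^sub>M N)"
    using measurable_compose[OF measurable_fst assms(5)] measurable_compose[OF measurable_snd assms(6)]
    by auto
  have "case_prod F \<in> borel_measurable (M \<Otimes>\<^sub>M N)"
    unfolding F_def case_prod_beta by measurable
  then have "(\<integral>\<^sup>+y. (\<integral>\<^sup>+t. F t y \<partial>M) \<partial>N) = (\<integral>\<^sup>+t. (\<integral>\<^sup>+y. F t y \<partial>N) \<partial>M)"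
    by (rule Fubini')
  moreover have "(\<integral>\<^sup>+t. F t y \<partial>M) = g y * (\<integral>\<^sup>+t\<in>{..y}. f t \<partial>M)" for y
    unfolding F_def by (subst nn_integral_cmult[symmetric])
      (auto intro!: nn_integral_cong simp: indicator_def mult.commute)
  moreover have "(\<integral>\<^sup>+y. F t y \<partial>N) = f t * (\<integral>\<^sup>+y\<in>{t..}. g y \<partial>N)" for t
    unfolding F_def by (subst nn_integral_cmult[symmetric])
      (auto intro!: nn_integral_cong simp: indicator_def mult.commute)
  ultimately show ?thesis by simp
qed

lemma borel_measurable_monotone:
  fixes f :: "real \<Rightarrow> ennreal"
  assumes "\<And>x y. x \<le> y \<Longrightarrow> f x \<le> f y"
  shows "f \<in> borel_measurable borel"
proof (rule borel_measurableI_greater)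
  fix a
  have "is_interval {x. a < f x}"
    unfolding is_interval_1 using assms less_le_trans by blast
  then show "{x \<in> space borel. a < f x} \<in> sets borel"
    by (simp add: real_interval_borel_measurable)
qed

lemma borel_measurable_antimono:
  fixes f :: "real \<Rightarrow> ennreal"
  assumes "\<And>x y. x \<le> y \<Longrightarrow> f y \<le> f x"
  shows "f \<in> borel_measurable borel"
proof (rule borel_measurableI_greater)
  fix a
  have "is_interval {x. a < f x}"
    unfolding is_interval_1 using assms less_le_trans by blast
  then show "{x \<in> space borel. a < f x} \<in> sets borel"
    by (simp add: real_interval_borel_measurable)
qed

text \<open>Take \<open>s = (a / b)\<^sup>1\<^sup>/\<^sup>p\<close>, for which the two summands agree; for \<open>a = 0\<close> let \<open>s\<close> tend to \<open>0\<close>.\<close>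

lemma epow_le_of_scaled_sums:
  assumes "1 < p" "0 < b"
    and bound: "\<And>s. 0 < s \<Longrightarrow> f \<le> ennreal s * ennreal b + ennreal (s powr (1 - p)) * a"
  shows "epow f p \<le> ennreal (2 powr p) * epow (ennreal b) (p - 1) * a"
proof (cases a rule: ennreal_zero_pos_top_cases)
  case 1
  have small: "f \<le> 0 + ennreal e" if "0 < e" for e
  proof -
    have "f \<le> ennreal (e / b) * ennreal b" using bound[of "e / b"] 1 that assms(1,2) by simp
    also have "\<dots> = ennreal e" using assms(1,2) that by (simp flip: ennreal_mult)
    finally show ?thesis by simp
  qed
  have "f \<le> 0" by (rule ennreal_le_epsilon, rule small)
  then show ?thesis using assms(1,2) by simp
next
  case (2 x)
  define s where "s = (x / b) powr (1 / p)"
  have s: "0 < s" and sp: "s powr p = x / b"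
    using assms(1,2) 2 by (simp_all add: s_def powr_powr)
  have "s powr (1 - p) * x = s * b"
    using assms(1,2) 2 s sp by (simp add: powr_diff)
  then have "ennreal (s powr (1 - p)) * a = ennreal (s * b)"
    using 2 by (simp flip: ennreal_mult)
  with bound[OF s] have "f \<le> ennreal (s * b) + ennreal (s * b)"
    using s assms(1,2) by (simp add: ennreal_mult)
  also have "\<dots> = ennreal (2 * (s * b))" using s assms(1,2) by (simp flip: ennreal_plus)
  finally have "epow f p \<le> ennreal ((2 * (s * b)) powr p)"
    using epow_mono[of p f "ennreal (2 * (s * b))"] s assms(1,2) by (simp add: epow_ennreal)
  also have "(2 * (s * b)) powr p = 2 powr p * b powr (p - 1) * x"
    using s assms(1,2) sp by (simp add: powr_mult powr_diff)
  finally show ?thesis using assms(1,2) 2 by (simp add: epow_ennreal ennreal_mult)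
next
  case 3
  then show ?thesis using assms(1,2) by (simp add: epow_ennreal ennreal_mult_top flip: ennreal_mult)
qed

text \<open>Hoelder's inequality for \<open>f = g\<^sup>1\<^sup>/\<^sup>q \<cdot> (f g\<^sup>-\<^sup>1\<^sup>/\<^sup>q)\<close>, up to the factor \<open>2\<^sup>p\<close>. Allowing this factor, a crude
  pointwise estimate replaces Young's inequality: either \<open>f \<le> s g\<close>, or \<open>f / (s g) > 1\<close> and then
  \<open>f \<le> f (f / (s g))\<^sup>p\<^sup>-\<^sup>1\<close>. It holds for all values in \<open>[0, \<infinity>]\<close>, because the last term is infinite
  whenever \<open>g = 0 < f\<close>.\<close>

lemma nn_integral_weak_Holder:
  assumes "1 < p" and [measurable]: "f \<in> borel_measurable M" "g \<in> borel_measurable M"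
    and g: "0 < (\<integral>\<^sup>+t. g t \<partial>M)" "(\<integral>\<^sup>+t. g t \<partial>M) < \<infinity>"
  shows "epow (\<integral>\<^sup>+t. f t \<partial>M) p
    \<le> ennreal (2 powr p) * epow (\<integral>\<^sup>+t. g t \<partial>M) (p - 1) * (\<integral>\<^sup>+t. epow (f t) p * epow (g t) (1 - p) \<partial>M)"
proof -
  obtain b where b: "0 < b" "(\<integral>\<^sup>+t. g t \<partial>M) = ennreal b"
    using g by (cases "\<integral>\<^sup>+t. g t \<partial>M" rule: ennreal_zero_pos_top_cases) auto
  have pointwise: "x \<le> ennreal s * y + ennreal (s powr (1 - p)) * (epow x p * epow y (1 - p))"
    if s: "0 < s" for s x y
  proof (cases "x \<le> ennreal s * y")
    case True
    then show ?thesis by (simp add: add_increasing2)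
  next
    case False
    then have "x \<noteq> 0" "y \<noteq> top" using s by (auto simp: ennreal_mult_top)
    show ?thesis
    proof (cases "x = top \<or> y = 0")
      case True
      then have "epow x p * epow y (1 - p) = top"
        using assms(1) \<open>x \<noteq> 0\<close> \<open>y \<noteq> top\<close>
        by (cases x rule: ennreal_zero_pos_top_cases; cases y rule: ennreal_zero_pos_top_cases)
           (auto simp: epow_def ennreal_top_mult ennreal_mult_top)
      then show ?thesis using s by (simp add: ennreal_mult_top)
    next
      case fin: False
      with \<open>x \<noteq> 0\<close> \<open>y \<noteq> top\<close> obtain a c where ac: "0 < a" "x = ennreal a" "0 < c" "y = ennreal c"
        by (cases x rule: ennreal_zero_pos_top_cases; cases y rule: ennreal_zero_pos_top_cases) auto
      with False s have "s * c < a" by (simp flip: ennreal_mult add: not_le)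
      then have "1 \<le> (a / (s * c)) powr (p - 1)"
        using ac s assms by (intro ge_one_powr_ge_zero) (auto simp: field_simps)
      then have "a * 1 \<le> a * (a / (s * c)) powr (p - 1)"
        using ac by (intro mult_left_mono) auto
      also have "(a / (s * c)) powr (p - 1) = a powr (p - 1) * (s powr (1 - p) * c powr (1 - p))"
        using ac s powr_minus[of s "p - 1"] powr_minus[of c "p - 1"]
        by (simp add: powr_divide powr_mult field_simps)
      also have "a * (a powr (p - 1) * (s powr (1 - p) * c powr (1 - p)))
          = s powr (1 - p) * (a powr p * c powr (1 - p))"
        using ac powr_mult_base[of a "p - 1"] by (simp add: ac_simps)
      finally have "x \<le> ennreal (s powr (1 - p)) * (epow x p * epow y (1 - p))"
        using ac s by (simp add: epow_ennreal flip: ennreal_mult)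
      then show ?thesis by (simp add: add_increasing)
    qed
  qed
  show ?thesis
    unfolding b(2)
  proof (rule epow_le_of_scaled_sums[OF \<open>1 < p\<close> b(1)])
    fix s :: real assume s: "0 < s"
    have "(\<integral>\<^sup>+t. f t \<partial>M)
        \<le> (\<integral>\<^sup>+t. ennreal s * g t + ennreal (s powr (1 - p)) * (epow (f t) p * epow (g t) (1 - p)) \<partial>M)"
      by (intro nn_integral_mono pointwise s)
    also have "\<dots> = ennreal s * ennreal b
        + ennreal (s powr (1 - p)) * (\<integral>\<^sup>+t. epow (f t) p * epow (g t) (1 - p) \<partial>M)"
      by (simp add: nn_integral_add nn_integral_cmult b(2))
    finally show "(\<integral>\<^sup>+t. f t \<partial>M) \<le> \<dots>" .
  qed
qed

section \<open>Powers of the tail\<close>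

locale atomless_tail_measure =
  fixes \<mu> :: "real measure"
  assumes space_eq [simp]: "space \<mu> = {0<..}"
    and id_measurable [measurable]: "(\<lambda>t. t) \<in> borel_measurable \<mu>"
    and tail_finite: "0 < x \<Longrightarrow> emeasure \<mu> {x<..} < \<infinity>"
    and atomless: "emeasure \<mu> {x} = 0"
begin

text \<open>Written as an integral of an indicator, so that \<open>V\<close> is decreasing on the whole line; the measure
  of \<open>{x<..}\<close> itself would be \<open>0\<close> for negative \<open>x\<close>, where that set is not measurable.\<close>

definition V :: "real \<Rightarrow> ennreal" where
  "V x = (\<integral>\<^sup>+t. indicator {x<..} t \<partial>\<mu>)"

lemma borel_Int_sets: "A \<in> sets borel \<Longrightarrow> A \<inter> {0<..} \<in> sets \<mu>"
  using measurable_sets[OF id_measurable, of A] by simp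

lemma tail_sets: "0 \<le> x \<Longrightarrow> {x<..} \<in> sets \<mu>"
  using borel_Int_sets[of "{x<..}"] by (simp add: Int_absorb2 subset_eq)

lemma V_eq: "0 \<le> x \<Longrightarrow> V x = emeasure \<mu> {x<..}"
  by (simp add: V_def tail_sets)

lemma V_finite: "0 < x \<Longrightarrow> V x < \<infinity>"
  using tail_finite by (simp add: V_eq)

lemma V_antimono: "x \<le> y \<Longrightarrow> V y \<le> V x"
  unfolding V_def by (intro nn_integral_mono) (auto simp: indicator_def)

lemma V_borel [measurable]: "V \<in> borel_measurable borel"
  by (intro borel_measurable_antimono V_antimono)

lemma AE_neq: "AE t in \<mu>. t \<noteq> y"
proof (cases "0 < y")
  case True
  have "{y} \<in> sets \<mu>" using borel_Int_sets[of "{y}"] True by simp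
  then show ?thesis using atomless by (intro AE_I[of _ _ "{y}"]) auto
qed (auto intro!: AE_I2)

lemma V_atLeast: "V y = (\<integral>\<^sup>+t. indicator {y..} t \<partial>\<mu>)"
  unfolding V_def using AE_neq[of y]
  by (intro nn_integral_cong_AE) (auto simp: indicator_def)

lemma sigma_finite: "sigma_finite_measure \<mu>"
proof
  define A where "A = range (\<lambda>n. {1 / real (Suc n)<..})"
  have "t \<in> \<Union>A" if "0 < t" for t
  proof -
    obtain n where "1 / real (Suc n) < t" using nat_approx_posE \<open>0 < t\<close> by metis
    then show ?thesis unfolding A_def by blast
  qed
  moreover have "0 < t" if "1 / real (Suc n) < t" for t n
    by (rule less_trans[OF _ that]) simp
  then have "\<Union>A \<subseteq> {0<..}"
    unfolding A_def by blast
  ultimately have "\<Union>A = space \<mu>" by auto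
  moreover have "A \<subseteq> sets \<mu>" by (auto simp: A_def tail_sets)
  moreover have "\<forall>a\<in>A. emeasure \<mu> a \<noteq> \<infinity>"
    using tail_finite unfolding A_def by (auto simp: less_top)
  ultimately show "\<exists>A. countable A \<and> A \<subseteq> sets \<mu> \<and> \<Union>A = space \<mu> \<and> (\<forall>a\<in>A. emeasure \<mu> a \<noteq> \<infinity>)"
    by (intro exI[of _ A]) (auto simp: A_def)
qed


lemma nn_integral_tail_transform:
  assumes x: "0 < x" and [measurable]: "\<phi> \<in> borel_measurable borel"
  shows "(\<integral>\<^sup>+t\<in>{x<..}. \<phi> (V t) \<partial>\<mu>) = (\<integral>\<^sup>+s\<in>{0<..<enn2real (V x)}. \<phi> (ennreal s) \<partial>lborel)"
proof -
  define N where "N = distr (density \<mu> (indicator {x<..})) borel (\<lambda>t. t)"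
  have em: "emeasure N A = (\<integral>\<^sup>+t. indicator {x<..} t * indicator A t \<partial>\<mu>)" if "A \<in> sets borel" for A
  proof -
    note [measurable] = that
    have "emeasure N A = (\<integral>\<^sup>+t. indicator A t \<partial>N)" by (simp add: N_def)
    also have "\<dots> = (\<integral>\<^sup>+t. indicator {x<..} t * indicator A t \<partial>\<mu>)"
      unfolding N_def by (subst nn_integral_distr) (auto simp: nn_integral_density)
    finally show ?thesis .
  qed
  have "emeasure N UNIV = V x" by (simp add: em V_def)
  moreover have "space N = UNIV" by (simp add: N_def)
  ultimately have "finite_borel_measure N"
    using V_finite[OF x]
    by (intro finite_borel_measure.intro finite_measureI finite_borel_measure_axioms.intro)
       (auto simp: N_def less_top)
  then interpret N: finite_borel_measure N .
  have "emeasure N {t} = 0" for t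
  proof -
    have "emeasure N {t} = (\<integral>\<^sup>+s. 0 \<partial>\<mu>)"
      unfolding em[OF borel_singleton[OF sets.empty_sets]] using AE_neq[of t]
      by (intro nn_integral_cong_AE) auto
    then show ?thesis by simp
  qed
  then have atomless: "measure N {t} = 0" for t by (simp add: measure_def)
  have tail: "ennreal (measure N {t<..}) = V t" if "x < t" for t
  proof -
    have "emeasure N {t<..} = V t"
      unfolding V_def by (subst em) (use that in \<open>auto intro!: nn_integral_cong simp: indicator_def\<close>)
    then show ?thesis by (simp add: N.emeasure_eq_measure)
  qed
  have mass: "measure N UNIV = enn2real (V x)"
    using \<open>emeasure N UNIV = V x\<close> by (simp add: measure_def)
  have "(\<integral>\<^sup>+t\<in>{x<..}. \<phi> (V t) \<partial>\<mu>)
      = (\<integral>\<^sup>+t. indicator {x<..} t * \<phi> (ennreal (measure N {t<..})) \<partial>\<mu>)"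
    by (intro nn_integral_cong) (auto simp: indicator_def tail)
  also have "\<dots> = (\<integral>\<^sup>+t. \<phi> (ennreal (measure N {t<..})) \<partial>N)"
  proof -
    have "(\<lambda>t. emeasure N {t<..}) \<in> borel_measurable borel"
      by (intro borel_measurable_antimono emeasure_mono) (auto simp: N_def)
    then have [measurable]: "(\<lambda>t. ennreal (measure N {t<..})) \<in> borel_measurable borel"
      by (simp add: N.emeasure_eq_measure)
    show ?thesis
      by (subst (2) N_def) (auto simp: nn_integral_distr nn_integral_density)
  qed
  also have "\<dots> = (\<integral>\<^sup>+s\<in>{0<..<enn2real (V x)}. \<phi> (ennreal s) \<partial>lborel)"
    using N.nn_integral_survival_transform[of "\<lambda>s. \<phi> (ennreal s)"] atomless mass by simp
  finally show ?thesis .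
qed

lemma nn_integral_tail_powr:
  assumes "0 < x" "0 < \<gamma>"
  shows "(\<integral>\<^sup>+t\<in>{x<..}. ennreal \<gamma> * epow (V t) (\<gamma> - 1) \<partial>\<mu>) = epow (V x) \<gamma>"
  using nn_integral_tail_transform[OF assms(1), of "\<lambda>a. ennreal \<gamma> * epow a (\<gamma> - 1)"]
    nn_integral_powr_Ioo[OF assms(2), of "enn2real (V x)"] V_finite[OF assms(1)]
  by simp

text \<open>The integrated form of \<open>-d(V\<^sup>\<gamma>) = \<gamma> V\<^sup>\<gamma>\<^sup>-\<^sup>1 d\<mu>\<close> on the interval from \<open>x\<close> to \<open>y\<close>; stated with a sum, as
  subtraction is truncated.\<close>

lemma tail_powr_split:
  assumes "0 < x" "x \<le> y" "0 < \<gamma>"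
  shows "epow (V x) \<gamma> = epow (V y) \<gamma> + (\<integral>\<^sup>+t\<in>{..y}. ennreal \<gamma> * epow (V t) (\<gamma> - 1) * indicator {x<..} t \<partial>\<mu>)"
proof -
  have "epow (V x) \<gamma> = (\<integral>\<^sup>+t\<in>{x<..}. ennreal \<gamma> * epow (V t) (\<gamma> - 1) \<partial>\<mu>)"
    using assms by (simp add: nn_integral_tail_powr)
  also have "\<dots> = (\<integral>\<^sup>+t. ennreal \<gamma> * epow (V t) (\<gamma> - 1) * indicator {y<..} t
      + ennreal \<gamma> * epow (V t) (\<gamma> - 1) * indicator {x<..} t * indicator {..y} t \<partial>\<mu>)"
    using assms by (intro nn_integral_cong) (auto simp: indicator_def)
  also have "\<dots> = (\<integral>\<^sup>+t\<in>{y<..}. ennreal \<gamma> * epow (V t) (\<gamma> - 1) \<partial>\<mu>)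
      + (\<integral>\<^sup>+t\<in>{..y}. ennreal \<gamma> * epow (V t) (\<gamma> - 1) * indicator {x<..} t \<partial>\<mu>)"
    by (subst nn_integral_add) auto
  finally show ?thesis using assms by (simp add: nn_integral_tail_powr)
qed

text \<open>Changing variables turns the part of the integral beyond \<open>e > 0\<close> into
  \<open>\<integral> \<delta> s\<^sup>-\<^sup>\<delta>\<^sup>-\<^sup>1 ds\<close> over \<open>(V(y), V(e))\<close>, which is at most \<open>V(y)\<^sup>-\<^sup>\<delta>\<close>. As \<open>\<mu>\<close> may have infinite mass
  near \<open>0\<close>, the change of variables is available only away from \<open>0\<close>, and \<open>e\<close> decreases to \<open>0\<close>
  afterwards.\<close>

lemma nn_integral_head_powr:
  assumes y: "0 < y" and d: "0 < \<delta>"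
  shows "(\<integral>\<^sup>+t\<in>{..y}. ennreal \<delta> * epow (V t) (- \<delta> - 1) \<partial>\<mu>) \<le> epow (V y) (- \<delta>)"
proof (cases "V y = 0")
  case True
  then show ?thesis using d by (simp add: epow_def)
next
  case False
  then obtain a where a: "0 < a" "V y = ennreal a"
    using V_finite[OF y] by (cases "V y" rule: ennreal_zero_pos_top_cases) auto
  define g where "g = (\<lambda>t. ennreal \<delta> * epow (V t) (- \<delta> - 1))"
  have [measurable]: "g \<in> borel_measurable \<mu>" unfolding g_def by measurable
  define e where "e = (\<lambda>n. 1 / real (Suc n))"
  have part: "(\<integral>\<^sup>+t. g t * indicator {e n<..y} t \<partial>\<mu>) \<le> epow (V y) (- \<delta>)" for n
  proof -
    have "(\<integral>\<^sup>+t. g t * indicator {e n<..y} t \<partial>\<mu>)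
        \<le> (\<integral>\<^sup>+t\<in>{e n<..}. ennreal \<delta> * epow (V t) (- \<delta> - 1) * indicator {V y..} (V t) \<partial>\<mu>)"
      using V_antimono by (intro nn_integral_mono) (auto simp: g_def indicator_def)
    also have "\<dots> = (\<integral>\<^sup>+s\<in>{0<..<enn2real (V (e n))}.
        ennreal \<delta> * epow (ennreal s) (- \<delta> - 1) * indicator {V y..} (ennreal s) \<partial>lborel)"
      by (rule nn_integral_tail_transform) (auto simp: e_def)
    also have "\<dots> \<le> (\<integral>\<^sup>+s\<in>{a..}. ennreal \<delta> * epow (ennreal s) (- \<delta> - 1) \<partial>lborel)"
      using a by (intro nn_integral_mono) (auto simp: indicator_def)
    also have "\<dots> = epow (V y) (- \<delta>)" using a d by (simp add: nn_integral_powr_atLeast)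
    finally show ?thesis .
  qed
  have e_mono: "e n \<le> e m" if "m \<le> n" for m n using that by (simp add: e_def frac_le)
  have "(\<integral>\<^sup>+t\<in>{..y}. g t \<partial>\<mu>) = (\<integral>\<^sup>+t. (SUP n. g t * indicator {e n<..y} t) \<partial>\<mu>)"
  proof (rule nn_integral_cong)
    fix t assume "t \<in> space \<mu>"
    then have "0 < t" by simp
    then obtain n where n: "e n < t" unfolding e_def using nat_approx_posE by metis
    show "g t * indicator {..y} t = (SUP n. g t * indicator {e n<..y} t)"
    proof (rule antisym)
      show "g t * indicator {..y} t \<le> (SUP n. g t * indicator {e n<..y} t)"
        using n by (intro SUP_upper2[of n]) (auto simp: indicator_def)
      show "(SUP n. g t * indicator {e n<..y} t) \<le> g t * indicator {..y} t"
        by (intro SUP_least) (auto simp: indicator_def)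
    qed
  qed
  also have "\<dots> = (SUP n. \<integral>\<^sup>+t. g t * indicator {e n<..y} t \<partial>\<mu>)"
  proof (rule nn_integral_monotone_convergence_SUP)
    show "incseq (\<lambda>n t. g t * indicator {e n<..y} t)"
    proof (intro incseq_SucI le_funI)
      fix n t
      have "e (Suc n) \<le> e n" by (simp add: e_mono)
      then show "g t * indicator {e n<..y} t \<le> g t * indicator {e (Suc n)<..y} t"
        by (auto simp: indicator_def)
    qed
  qed simp
  also have "\<dots> \<le> epow (V y) (- \<delta>)" by (intro SUP_least part)
  finally show ?thesis by (simp add: g_def)
qed

section \<open>Comparing tail integrals with powers of tail integrals\<close>

text \<open>Hoelder's inequality with the weight \<open>V\<^sup>-\<^sup>1\<^sup>/\<^sup>2\<close>. The exponent splits \<open>V\<^sup>p\<^sup>-\<^sup>1\<close>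
  evenly: one half comes out as the \<open>(p - 1)\<close>-th power of \<open>2 V(x)\<^sup>1\<^sup>/\<^sup>2\<close>, the integral of the
  weight over the tail, and the other half stays with \<open>r\<^sup>p\<close>.\<close>

lemma tail_power_le_weighted:
  assumes p: "1 < p" and x: "0 < x" and [measurable]: "r \<in> borel_measurable \<mu>"
  shows "epow (\<integral>\<^sup>+t\<in>{x<..}. r t \<partial>\<mu>) p
    \<le> ennreal (2 powr (2 * p - 1)) * epow (V x) ((p - 1) / 2)
       * (\<integral>\<^sup>+t\<in>{x<..}. epow (r t) p * epow (V t) ((p - 1) / 2) \<partial>\<mu>)"
proof (cases "V x = 0")
  case True
  have "AE t in \<mu>. indicator {x<..} t = (0 :: ennreal)"
    using True x unfolding V_def
    by (subst nn_integral_0_iff_AE[symmetric]) (auto intro!: borel_measurable_indicator tail_sets)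
  then have "(\<integral>\<^sup>+t\<in>{x<..}. r t \<partial>\<mu>) = (\<integral>\<^sup>+t. 0 \<partial>\<mu>)"
    by (intro nn_integral_cong_AE) auto
  then show ?thesis using p by simp
next
  case False
  then obtain a where a: "0 < a" "V x = ennreal a"
    using V_finite[OF x] by (cases "V x" rule: ennreal_zero_pos_top_cases) auto
  define g where "g = (\<lambda>t. epow (V t) (- 1 / 2) * indicator {x<..} t)"
  have [measurable]: "g \<in> borel_measurable \<mu>" unfolding g_def by measurable
  have "epow (V x) (1 / 2) = (\<integral>\<^sup>+t. ennreal (1 / 2) * g t \<partial>\<mu>)"
    using nn_integral_tail_powr[OF x, of "1 / 2"] by (simp add: g_def mult.assoc)
  also have "\<dots> = ennreal (1 / 2) * (\<integral>\<^sup>+t. g t \<partial>\<mu>)"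
    by (rule nn_integral_cmult) measurable
  finally have half: "epow (V x) (1 / 2) = ennreal (1 / 2) * (\<integral>\<^sup>+t. g t \<partial>\<mu>)" .
  have "(\<integral>\<^sup>+t. g t \<partial>\<mu>) = ennreal 2 * (ennreal (1 / 2) * (\<integral>\<^sup>+t. g t \<partial>\<mu>))"
  proof -
    have "ennreal 2 * ennreal (1 / 2) = 1" by (subst ennreal_mult[symmetric]) auto
    then show ?thesis by (simp only: mult.assoc[symmetric] mult_1)
  qed
  also have "\<dots> = ennreal (2 * a powr (1 / 2))"
    unfolding half[symmetric] using a by (simp add: epow_ennreal ennreal_mult)
  finally have int_g: "(\<integral>\<^sup>+t. g t \<partial>\<mu>) = ennreal (2 * a powr (1 / 2))" .
  have "epow (\<integral>\<^sup>+t. r t * indicator {x<..} t \<partial>\<mu>) p \<le> ennreal (2 powr p) * epow (\<integral>\<^sup>+t. g t \<partial>\<mu>) (p - 1)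
      * (\<integral>\<^sup>+t. epow (r t * indicator {x<..} t) p * epow (g t) (1 - p) \<partial>\<mu>)"
    using p a by (intro nn_integral_weak_Holder) (auto simp: int_g)
  also have "(\<integral>\<^sup>+t. epow (r t * indicator {x<..} t) p * epow (g t) (1 - p) \<partial>\<mu>)
      = (\<integral>\<^sup>+t\<in>{x<..}. epow (r t) p * epow (V t) ((p - 1) / 2) \<partial>\<mu>)"
  proof (rule nn_integral_cong)
    have "epow (epow b (- 1 / 2)) (1 - p) = epow b ((p - 1) / 2)" for b
      unfolding epow_epow by (rule arg_cong[where f="epow b"]) (simp add: field_simps)
    then show "epow (r t * indicator {x<..} t) p * epow (g t) (1 - p)
        = epow (r t) p * epow (V t) ((p - 1) / 2) * indicator {x<..} t" for t
      using p by (auto simp: g_def indicator_def)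
  qed
  also have "ennreal (2 powr p) * epow (\<integral>\<^sup>+t. g t \<partial>\<mu>) (p - 1)
      = ennreal (2 powr (2 * p - 1)) * epow (V x) ((p - 1) / 2)"
  proof -
    have "2 powr p * (2 * a powr (1 / 2)) powr (p - 1) = 2 powr p * 2 powr (p - 1) * a powr ((p - 1) / 2)"
      using a by (simp add: powr_mult powr_powr)
    also have "2 powr p * 2 powr (p - 1) = (2 powr (2 * p - 1) :: real)"
      by (simp flip: powr_add)
    finally show ?thesis using a by (simp add: int_g epow_ennreal flip: ennreal_mult)
  qed
  finally show ?thesis .
qed

text \<open>This combines Hardy's inequality with the passage to \<open>p\<close>-th powers. The function \<open>H\<close> is minus the
  derivative, with respect to \<open>\<mu>\<close>, of \<open>V(x)\<^sup>d \<integral>\<^sub>x\<^sup>\<infinity> r\<^sup>p V\<^sup>d d\<mu>\<close>. In \<open>\<integral> H V\<^sup>1\<^sup>-\<^sup>p d\<mu>\<close> the first summand of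
  \<open>H\<close> gives \<open>\<integral> r\<^sup>p d\<mu>\<close> since \<open>2 d = p - 1\<close>, and the second gives at most the same amount
  after exchanging the integrals, since \<open>\<integral>\<^sub>0\<^sup>y d V\<^sup>-\<^sup>d\<^sup>-\<^sup>1 d\<mu> \<le> V(y)\<^sup>-\<^sup>d\<close>.\<close>

lemma hardy_majorant:
  assumes p: "1 < p" and [measurable]: "r \<in> borel_measurable \<mu>"
  obtains H where "H \<in> borel_measurable \<mu>"
    and "\<And>x. 0 < x \<Longrightarrow> epow (\<integral>\<^sup>+t\<in>{x<..}. r t \<partial>\<mu>) p
           \<le> ennreal (2 powr (2 * p - 1)) * (\<integral>\<^sup>+t\<in>{x<..}. H t \<partial>\<mu>)"
    and "(\<integral>\<^sup>+t. H t * epow (V t) (1 - p) \<partial>\<mu>) \<le> 2 * (\<integral>\<^sup>+t. epow (r t) p \<partial>\<mu>)"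
proof -
  define d where "d = (p - 1) / 2"
  have d: "0 < d" and p_eq: "1 - p = - (2 * d)" using p by (simp_all add: d_def field_simps)
  define K where "K = (\<lambda>y. epow (r y) p * epow (V y) d)"
  define J where "J = (\<lambda>t. \<integral>\<^sup>+y\<in>{t..}. K y \<partial>\<mu>)"
  define H where "H = (\<lambda>t. epow (V t) (2 * d) * epow (r t) p + ennreal d * epow (V t) (d - 1) * J t)"
  have [measurable]: "K \<in> borel_measurable \<mu>" unfolding K_def by measurable
  have "J \<in> borel_measurable borel"
    unfolding J_def by (intro borel_measurable_antimono nn_integral_mono) (auto simp: indicator_def)
  then have [measurable]: "J \<in> borel_measurable \<mu>"
    using measurable_compose[OF id_measurable] by simp
  have H_meas [measurable]: "H \<in> borel_measurable \<mu>" unfolding H_def by measurable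
  have lower: "epow (V x) d * (\<integral>\<^sup>+y\<in>{x<..}. K y \<partial>\<mu>) \<le> (\<integral>\<^sup>+t\<in>{x<..}. H t \<partial>\<mu>)" if x: "0 < x" for x
  proof -
    let ?f = "\<lambda>t. ennreal d * epow (V t) (d - 1) * indicator {x<..} t"
    let ?g = "\<lambda>y. K y * indicator {x<..} y"
    have "epow (V x) d * (\<integral>\<^sup>+y\<in>{x<..}. K y \<partial>\<mu>) = (\<integral>\<^sup>+y. epow (V x) d * ?g y \<partial>\<mu>)"
      by (rule nn_integral_cmult[symmetric]) measurable
    also have "\<dots> = (\<integral>\<^sup>+y. epow (V y) d * ?g y + ?g y * (\<integral>\<^sup>+t\<in>{..y}. ?f t \<partial>\<mu>) \<partial>\<mu>)"
    proof (rule nn_integral_cong)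
      fix y show "epow (V x) d * ?g y = epow (V y) d * ?g y + ?g y * (\<integral>\<^sup>+t\<in>{..y}. ?f t \<partial>\<mu>)"
      proof (cases "x < y")
        case True
        show ?thesis
          unfolding tail_powr_split[OF x less_imp_le[OF True] d] by (simp add: distrib_left mult.commute)
      qed simp
    qed
    also have "\<dots> = (\<integral>\<^sup>+y. epow (V y) d * ?g y \<partial>\<mu>) + (\<integral>\<^sup>+y. ?g y * (\<integral>\<^sup>+t\<in>{..y}. ?f t \<partial>\<mu>) \<partial>\<mu>)"
    proof (rule nn_integral_add)
      have "(\<lambda>z. \<integral>\<^sup>+t\<in>{..z}. ?f t \<partial>\<mu>) \<in> borel_measurable borel"
        by (intro borel_measurable_monotone nn_integral_mono) (auto simp: indicator_def)
      from measurable_compose[OF id_measurable this]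
      show "(\<lambda>y. ?g y * (\<integral>\<^sup>+t\<in>{..y}. ?f t \<partial>\<mu>)) \<in> borel_measurable \<mu>" by simp
    qed measurable
    also have "(\<integral>\<^sup>+y. ?g y * (\<integral>\<^sup>+t\<in>{..y}. ?f t \<partial>\<mu>) \<partial>\<mu>) = (\<integral>\<^sup>+t. ?f t * (\<integral>\<^sup>+y\<in>{t..}. ?g y \<partial>\<mu>) \<partial>\<mu>)"
      by (rule nn_integral_triangle_swap[OF sigma_finite sigma_finite]) measurable
    also have "\<dots> \<le> (\<integral>\<^sup>+t. ?f t * J t \<partial>\<mu>)"
      unfolding J_def by (intro nn_integral_mono mult_left_mono) (auto simp: indicator_def)
    also have "(\<integral>\<^sup>+y. epow (V y) d * ?g y \<partial>\<mu>) = (\<integral>\<^sup>+t. epow (V t) (2 * d) * epow (r t) p * indicator {x<..} t \<partial>\<mu>)"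
      using epow_add[OF d d] by (intro nn_integral_cong) (simp add: K_def ac_simps)
    also have "\<dots> + (\<integral>\<^sup>+t. ?f t * J t \<partial>\<mu>) = (\<integral>\<^sup>+t\<in>{x<..}. H t \<partial>\<mu>)"
      by (subst nn_integral_add[symmetric]) (auto intro!: nn_integral_cong simp: H_def indicator_def)
    finally show ?thesis by (simp add: add_left_mono)
  qed
  show thesis
  proof
    show "H \<in> borel_measurable \<mu>" by (rule H_meas)
    fix x :: real assume x: "0 < x"
    have "epow (\<integral>\<^sup>+t\<in>{x<..}. r t \<partial>\<mu>) p
        \<le> ennreal (2 powr (2 * p - 1)) * (epow (V x) d * (\<integral>\<^sup>+y\<in>{x<..}. K y \<partial>\<mu>))"
      using tail_power_le_weighted[OF p x, of r] by (simp add: d_def K_def mult.assoc)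
    also have "\<dots> \<le> ennreal (2 powr (2 * p - 1)) * (\<integral>\<^sup>+t\<in>{x<..}. H t \<partial>\<mu>)"
      by (intro mult_left_mono lower x) simp
    finally show "epow (\<integral>\<^sup>+t\<in>{x<..}. r t \<partial>\<mu>) p \<le> \<dots>" .
  next
    let ?f = "\<lambda>t. ennreal d * epow (V t) (- d - 1)"
    have "H t * epow (V t) (1 - p) \<le> epow (r t) p + ?f t * J t" if "t \<in> space \<mu>" for t
    proof -
      have t: "0 < t" using that by simp
      show ?thesis
      proof (cases "V t" rule: ennreal_zero_pos_top_cases)
        case 1
        then show ?thesis using d p_eq
          by (auto simp: H_def epow_def distrib_right ennreal_mult_top ennreal_top_mult)
      next
        case (2 a)
        have "epow (V t) (2 * d) * epow (V t) (1 - p) = 1"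
          using 2 unfolding p_eq epow_ennreal[OF 2(1)] 2(2) by (simp flip: ennreal_mult powr_add)
        moreover have "epow (V t) (d - 1) * epow (V t) (1 - p) = epow (V t) (- d - 1)"
          using 2 epow_add_fin[of "V t" "d - 1" "1 - p"] by (simp add: p_eq)
        ultimately have "H t * epow (V t) (1 - p) = epow (r t) p + ?f t * J t"
          unfolding H_def distrib_right by (simp add: ac_simps)
        then show ?thesis by simp
      next
        case 3
        then show ?thesis using V_finite[OF t] by simp
      qed
    qed
    then have "(\<integral>\<^sup>+t. H t * epow (V t) (1 - p) \<partial>\<mu>) \<le> (\<integral>\<^sup>+t. epow (r t) p + ?f t * J t \<partial>\<mu>)"
      by (rule nn_integral_mono)
    also have "\<dots> = (\<integral>\<^sup>+t. epow (r t) p \<partial>\<mu>) + (\<integral>\<^sup>+t. ?f t * J t \<partial>\<mu>)"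
      by (rule nn_integral_add) measurable
    also have "(\<integral>\<^sup>+t. ?f t * J t \<partial>\<mu>) = (\<integral>\<^sup>+y. K y * (\<integral>\<^sup>+t\<in>{..y}. ?f t \<partial>\<mu>) \<partial>\<mu>)"
      unfolding J_def
      by (rule nn_integral_triangle_swap[OF sigma_finite sigma_finite, symmetric]) measurable
    also have "\<dots> \<le> (\<integral>\<^sup>+y. epow (r y) p \<partial>\<mu>)"
    proof (rule nn_integral_mono)
      fix y assume "y \<in> space \<mu>"
      then have y: "0 < y" by simp
      have "K y * (\<integral>\<^sup>+t\<in>{..y}. ?f t \<partial>\<mu>) \<le> K y * epow (V y) (- d)"
        by (intro mult_left_mono nn_integral_head_powr y d) simp
      also have "\<dots> \<le> epow (r y) p"
      proof (cases "V y" rule: ennreal_zero_pos_top_cases)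
        case (2 a)
        have "epow (V y) d * epow (V y) (- d) = 1"
          unfolding 2(2) epow_ennreal[OF 2(1)] using 2 by (simp flip: ennreal_mult powr_add)
        then show ?thesis by (simp add: K_def mult.assoc)
      qed (use V_finite[OF y] d in \<open>auto simp: K_def\<close>)
      finally show "K y * (\<integral>\<^sup>+t\<in>{..y}. ?f t \<partial>\<mu>) \<le> epow (r y) p" .
    qed
    finally show "(\<integral>\<^sup>+t. H t * epow (V t) (1 - p) \<partial>\<mu>) \<le> 2 * (\<integral>\<^sup>+t. epow (r t) p \<partial>\<mu>)"
      by (simp add: add_left_mono mult_2)
  qed
qed

text \<open>If \<open>h\<close> is a unit mass at \<open>y\<close>, the tail integral is the indicator of \<open>(0, y)\<close>, and the cheapest
  multiple of an indicator of \<open>(y, \<infinity>)\<close> whose \<open>\<mu>\<close>-tail dominates it is \<open>1/V(y)\<close> times that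
  indicator. Adding up \<open>p\<close>-th powers over \<open>y\<close> suggests \<open>A\<^sup>p(t) = \<integral>\<^sub>0\<^sup>t h V\<^sup>-\<^sup>p\<close>. For the domination,
  write \<open>V(y)\<^sup>p\<close> as \<open>\<integral>\<^sub>y\<^sup>\<infinity> p V\<^sup>p\<^sup>-\<^sup>1 d\<mu>\<close> and exchange integrals, so that
  \<open>\<integral>\<^sub>x\<^sup>\<infinity> h \<le> p \<integral>\<^sub>x\<^sup>\<infinity> V\<^sup>p\<^sup>-\<^sup>1 A\<^sup>p d\<mu>\<close>; in the integrand, \<open>(V A)\<^sup>p\<^sup>-\<^sup>1\<close> is at most the
  \<open>(p - 1)\<close>-th power of the tail integral of \<open>A\<close>, because \<open>A\<close> is increasing.\<close>

lemma tail_power_majorant: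
  fixes h :: "real \<Rightarrow> ennreal"
  assumes p: "1 < p" and N: "sigma_finite_measure N" "space N = {0<..}"
    and [measurable]: "(\<lambda>t. t) \<in> borel_measurable N" "h \<in> borel_measurable N"
    and fin: "(\<integral>\<^sup>+y. h y * epow (V y) (1 - p) \<partial>N) < \<infinity>"
  obtains A where "A \<in> borel_measurable \<mu>"
    and "\<And>x. 0 < x \<Longrightarrow> (\<integral>\<^sup>+y\<in>{x<..}. h y \<partial>N)
           \<le> ennreal p * epow (\<integral>\<^sup>+t\<in>{x<..}. A t \<partial>\<mu>) p"
    and "(\<integral>\<^sup>+t. epow (A t) p \<partial>\<mu>) \<le> (\<integral>\<^sup>+y. h y * epow (V y) (1 - p) \<partial>N)"
proof -
  define k where "k = (\<lambda>y. h y * epow (V y) (- p))"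
  define B where "B = (\<lambda>t. \<integral>\<^sup>+y\<in>{..t}. k y \<partial>N)"
  define A where "A = (\<lambda>t. epow (B t) (1 / p))"
  have VN [measurable]: "V \<in> borel_measurable N"
    using measurable_compose[OF assms(4) V_borel] by simp
  have [measurable]: "k \<in> borel_measurable N" unfolding k_def by measurable
  have "B \<in> borel_measurable borel"
    unfolding B_def by (intro borel_measurable_monotone nn_integral_mono) (auto simp: indicator_def)
  from measurable_compose[OF id_measurable this]
  have [measurable]: "B \<in> borel_measurable \<mu>" by simp
  have A_meas [measurable]: "A \<in> borel_measurable \<mu>" unfolding A_def by measurable
  have A_mono: "A s \<le> A t" if "s \<le> t" for s t
    unfolding A_def B_def using p that
    by (intro epow_mono nn_integral_mono) (auto simp: indicator_def)
  have A_pow: "epow (A t) p = B t" for t unfolding A_def using p by (simp add: epow_inverse)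
  have V_cases: "V y = 0 \<or> (\<exists>a>0. V y = ennreal a)" if "0 < y" for y
    using V_finite[OF that] by (cases "V y" rule: ennreal_zero_pos_top_cases) auto
  show thesis
  proof
    show "A \<in> borel_measurable \<mu>" by (rule A_meas)
    have "(\<integral>\<^sup>+t. epow (A t) p \<partial>\<mu>) = (\<integral>\<^sup>+t. 1 * (\<integral>\<^sup>+y\<in>{..t}. k y \<partial>N) \<partial>\<mu>)"
      by (simp add: A_pow B_def)
    also have "\<dots> = (\<integral>\<^sup>+y. k y * (\<integral>\<^sup>+t\<in>{y..}. 1 \<partial>\<mu>) \<partial>N)"
      by (rule nn_integral_triangle_swap[OF N(1) sigma_finite]) measurable
    also have "\<dots> = (\<integral>\<^sup>+y. k y * V y \<partial>N)" by (simp add: V_atLeast)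
    also have "\<dots> \<le> (\<integral>\<^sup>+y. h y * epow (V y) (1 - p) \<partial>N)"
    proof (rule nn_integral_mono)
      fix y assume "y \<in> space N"
      then have "0 < y" using N by simp
      from V_cases[OF this] show "k y * V y \<le> h y * epow (V y) (1 - p)"
      proof
        assume "\<exists>a>0. V y = ennreal a"
        then have "epow (V y) (1 - p) = V y * epow (V y) (- p)"
          using epow_add_fin[of "V y" 1 "- p"] by auto
        then show ?thesis by (simp add: k_def ac_simps)
      qed simp
    qed
    finally show "(\<integral>\<^sup>+t. epow (A t) p \<partial>\<mu>) \<le> (\<integral>\<^sup>+y. h y * epow (V y) (1 - p) \<partial>N)" .
  next
    fix x :: real assume x: "0 < x"
    define G where "G = (\<integral>\<^sup>+t\<in>{x<..}. A t \<partial>\<mu>)"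
    let ?f = "\<lambda>t. ennreal p * epow (V t) (p - 1) * indicator {x<..} t"
    let ?k = "\<lambda>y. k y * indicator {x<..} y"
    \<comment> \<open>Finiteness of the cost forces \<open>h\<close> to vanish where \<open>V\<close> does; elsewhere \<open>V\<^sup>-\<^sup>p V\<^sup>p = 1\<close>.\<close>
    have "AE y in N. h y * epow (V y) (1 - p) \<noteq> \<infinity>"
      using fin by (intro nn_integral_noteq_infinite) auto
    then have ae: "AE y in N. h y * indicator {x<..} y \<le> ?k y * (\<integral>\<^sup>+t\<in>{y..}. ?f t \<partial>\<mu>)"
    proof eventually_elim
      case (elim y)
      show ?case
      proof (cases "x < y")
        case True
        then have y: "0 < y" using x by simp
        have "(\<integral>\<^sup>+t\<in>{y<..}. ennreal p * epow (V t) (p - 1) \<partial>\<mu>) \<le> (\<integral>\<^sup>+t\<in>{y..}. ?f t \<partial>\<mu>)"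
          using True by (intro nn_integral_mono) (auto simp: indicator_def)
        then have *: "epow (V y) p \<le> (\<integral>\<^sup>+t\<in>{y..}. ?f t \<partial>\<mu>)"
          using nn_integral_tail_powr[OF y, of p] p by simp
        have "h y \<le> k y * epow (V y) p"
          using V_cases[OF y]
        proof
          assume "V y = 0"
          then have "h y = 0" using elim p by (auto simp: epow_def ennreal_mult_top split: if_splits)
          then show ?thesis by simp
        next
          assume "\<exists>a>0. V y = ennreal a"
          then have "epow (V y) (- p) * epow (V y) p = 1"
            using epow_add_fin[of "V y" "- p" p] by (auto simp: epow_def)
          then show ?thesis by (simp add: k_def mult.assoc)
        qed
        also have "\<dots> \<le> k y * (\<integral>\<^sup>+t\<in>{y..}. ?f t \<partial>\<mu>)"
          by (intro mult_left_mono *) simp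
        finally show ?thesis using True by simp
      qed simp
    qed
    have "(\<integral>\<^sup>+y\<in>{x<..}. h y \<partial>N) \<le> (\<integral>\<^sup>+y. ?k y * (\<integral>\<^sup>+t\<in>{y..}. ?f t \<partial>\<mu>) \<partial>N)"
      by (rule nn_integral_mono_AE[OF ae])
    also have "\<dots> = (\<integral>\<^sup>+t. ?f t * (\<integral>\<^sup>+y\<in>{..t}. ?k y \<partial>N) \<partial>\<mu>)"
      by (rule nn_integral_triangle_swap[OF N(1) sigma_finite, symmetric]) measurable
    also have "\<dots> \<le> (\<integral>\<^sup>+t. ennreal p * epow G (p - 1) * (A t * indicator {x<..} t) \<partial>\<mu>)"
    proof (rule nn_integral_mono)
      fix t
      show "?f t * (\<integral>\<^sup>+y\<in>{..t}. ?k y \<partial>N) \<le> ennreal p * epow G (p - 1) * (A t * indicator {x<..} t)"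
      proof (cases "x < t")
        case True
        have "V t * A t = (\<integral>\<^sup>+s. A t * indicator {t<..} s \<partial>\<mu>)"
          using True x by (subst nn_integral_cmult) (auto intro!: borel_measurable_indicator tail_sets simp: V_def mult.commute)
        also have "\<dots> \<le> G"
          unfolding G_def using True A_mono by (intro nn_integral_mono) (auto simp: indicator_def)
        finally have VA: "V t * A t \<le> G" .
        have "(\<integral>\<^sup>+y\<in>{..t}. ?k y \<partial>N) \<le> B t"
          unfolding B_def by (intro nn_integral_mono) (auto simp: indicator_def)
        also have "B t = epow (A t) (p - 1) * A t"
          using A_pow[of t] epow_add[of "p - 1" 1 "A t"] p by simp
        finally have "?f t * (\<integral>\<^sup>+y\<in>{..t}. ?k y \<partial>N) \<le> ?f t * (epow (A t) (p - 1) * A t)"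
          by (intro mult_left_mono) auto
        also have "\<dots> = ennreal p * epow (V t * A t) (p - 1) * A t"
          using True p by (simp add: epow_mult ac_simps)
        also have "\<dots> \<le> ennreal p * epow G (p - 1) * A t"
          using p by (intro mult_right_mono mult_left_mono epow_mono VA) auto
        finally show ?thesis using True by simp
      qed simp
    qed
    also have "\<dots> = ennreal p * epow G (p - 1) * G"
      unfolding G_def by (rule nn_integral_cmult) measurable
    also have "\<dots> = ennreal p * epow G p"
      using epow_add[of "p - 1" 1 G] p by (simp add: mult.assoc)
    finally show "(\<integral>\<^sup>+y\<in>{x<..}. h y \<partial>N) \<le> ennreal p * epow G p" .
  qed
qed

end

section \<open>Weighted supremum norms and monotone operators\<close>

abbreviation "L \<equiv> lebesgue_on {0<..} :: real measure"

lemma id_borel_measurable_lebesgue_on [measurable]: "(\<lambda>t. t) \<in> borel_measurable L"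
  by (intro measurable_restrict_space1 measurable_completion) simp

lemma sigma_finite_lebesgue_on: "sigma_finite_measure L"
proof
  define A where "A = range (\<lambda>n. {0<..real n})"
  have "{0<..real n} \<in> sets L" for n by (auto simp: sets_restrict_space_iff)
  then have "A \<subseteq> sets L" by (auto simp: A_def)
  moreover have "\<Union>A = {0<..}" using real_arch_simple by (auto simp: A_def)
  moreover have "emeasure L {0<..real n} = ennreal (real n)" for n
    by (subst emeasure_restrict_space) auto
  then have "\<forall>a\<in>A. emeasure L a \<noteq> \<infinity>" by (auto simp: A_def)
  ultimately show "\<exists>A. countable A \<and> A \<subseteq> sets L \<and> \<Union>A = space L \<and> (\<forall>a\<in>A. emeasure L a \<noteq> \<infinity>)"
    by (intro exI[of _ A]) (auto simp: A_def space_restrict_space)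
qed

lemma tail_integral_lebesgue_on:
  assumes "0 \<le> x"
  shows "(\<integral>\<^sup>+t\<in>{x<..}. h t \<partial>lebesgue) = (\<integral>\<^sup>+t\<in>{x<..}. h t \<partial>L)"
  using assms by (subst nn_integral_restrict_space) (auto intro!: nn_integral_cong simp: indicator_def)

lemma tail_integral_measurable [measurable]: "(\<lambda>x. \<integral>\<^sup>+t\<in>{x<..}. h t \<partial>lebesgue) \<in> borel_measurable L"
proof -
  have "(\<lambda>x. \<integral>\<^sup>+t\<in>{x<..}. h t \<partial>lebesgue) \<in> borel_measurable borel"
    by (intro borel_measurable_antimono nn_integral_mono) (auto simp: indicator_def)
  from measurable_compose[OF id_borel_measurable_lebesgue_on this] show ?thesis .
qed

lemma wnorm_inf_le_iff:
  assumes "f \<in> Mplus" "w \<in> Mplus"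
  shows "wnorm_inf w f \<le> b \<longleftrightarrow> (AE x in L. f x * w x \<le> b)"
proof
  assume le: "wnorm_inf w f \<le> b"
  have "AE x in L. f x * w x \<le> esssup L (\<lambda>x. f x * w x)" by (rule esssup_AE)
  then show "AE x in L. f x * w x \<le> b"
    by eventually_elim (rule order_trans[OF _ le[unfolded wnorm_inf_def]])
next
  have "(\<lambda>x. f x * w x) \<in> borel_measurable L"
    using assms unfolding Mplus_def by measurable
  then show "wnorm_inf w f \<le> b" if "AE x in L. f x * w x \<le> b"
    unfolding wnorm_inf_def using that by (rule esssup_I)
qed

lemma wnorm_inf_epow_le_iff:
  assumes "0 < p" and f: "f \<in> Mplus" and w: "w \<in> Mplus"
  shows "wnorm_inf (\<lambda>x. epow (w x) p) (\<lambda>x. epow (f x) p) \<le> epow b p \<longleftrightarrow> wnorm_inf w f \<le> b"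
proof -
  have "(\<lambda>x. epow (f x) p) \<in> Mplus" "(\<lambda>x. epow (w x) p) \<in> Mplus"
    using f w unfolding Mplus_def by measurable
  from wnorm_inf_le_iff[OF this] wnorm_inf_le_iff[OF f w] assms(1) show ?thesis
    by (simp add: epow_mult[symmetric] epow_le_iff)
qed

lemma monotone_quasilinear_domination:
  assumes T: "monotone_quasilinear T" and w: "w \<in> Mplus"
  obtains c :: real where "0 < c"
    and "\<And>f g K b. f \<in> Mplus \<Longrightarrow> g \<in> Mplus \<Longrightarrow> 0 \<le> K \<Longrightarrow> (\<And>x. 0 < x \<Longrightarrow> f x \<le> ennreal K * g x)
      \<Longrightarrow> wnorm_inf w (T g) \<le> b \<Longrightarrow> wnorm_inf w (T f) \<le> ennreal (c * K) * b"
proof -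
  from T obtain c where c: "0 < c"
    and mono: "\<And>f g. f \<in> Mplus \<Longrightarrow> g \<in> Mplus \<Longrightarrow> (AE x in L. f x \<le> g x)
      \<Longrightarrow> AE x in L. T f x \<le> ennreal c * T g x"
    unfolding monotone_quasilinear_def by blast
  have T_Mplus: "\<And>f. f \<in> Mplus \<Longrightarrow> T f \<in> Mplus"
    and hom: "\<And>l f. 0 \<le> l \<Longrightarrow> f \<in> Mplus \<Longrightarrow> AE x in L. T (\<lambda>y. ennreal l * f y) x = ennreal l * T f x"
    using T unfolding monotone_quasilinear_def by blast+
  show thesis
  proof (rule that[OF c])
    fix f g K b
    assume f: "f \<in> Mplus" and g: "g \<in> Mplus" and K: "(0::real) \<le> K"
      and le: "\<And>x. 0 < x \<Longrightarrow> f x \<le> ennreal K * g x" and b: "wnorm_inf w (T g) \<le> b"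
    have Kg: "(\<lambda>x. ennreal K * g x) \<in> Mplus" using g unfolding Mplus_def by measurable
    have "AE x in L. f x \<le> ennreal K * g x" using le by (intro AE_I2) simp
    from mono[OF f Kg this] hom[OF K g] b[unfolded wnorm_inf_le_iff[OF T_Mplus[OF g] w]]
    have "AE x in L. T f x * w x \<le> ennreal (c * K) * b"
    proof eventually_elim
      case (elim x)
      have "T f x * w x \<le> ennreal c * (ennreal K * T g x) * w x"
        using elim(1,2) by (intro mult_right_mono) auto
      also have "\<dots> = ennreal (c * K) * (T g x * w x)"
        using c K by (simp add: ennreal_mult mult.assoc)
      also have "\<dots> \<le> ennreal (c * K) * b" using elim(3) by (intro mult_left_mono) auto
      finally show ?case .
    qed
    then show "wnorm_inf w (T f) \<le> ennreal (c * K) * b"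
      by (simp add: wnorm_inf_le_iff T_Mplus f w)
  qed
qed

section \<open>Weights as densities\<close>

lemma conj_weight_identity:
  assumes "1 < p" "0 < y"
  shows "epow (epow y (1 - conj_exp p)) p * y = epow y (1 - conj_exp p)"
proof (cases y rule: ennreal_zero_pos_top_cases)
  case (2 a)
  have "(1 - conj_exp p) * p + 1 = 1 - conj_exp p" using assms by (simp add: conj_exp_def field_simps)
  then have "a powr ((1 - conj_exp p) * p) * a = a powr (1 - conj_exp p)"
    using 2 powr_add[of a "(1 - conj_exp p) * p" 1] by simp
  then show ?thesis using 2 by (simp add: powr_powr epow_ennreal flip: ennreal_mult)
next
  case 3
  have "1 - conj_exp p < 0" using assms by (simp add: conj_exp_def field_simps)
  then show ?thesis using 3 assms by (simp add: epow_def)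
qed (use assms in auto)

text \<open>Where the weight is infinite the density \<open>u\<close> vanishes, and \<open>h = r u\<close> can hold only if \<open>h = 0\<close>;
  finiteness of the weighted power guarantees this.\<close>

lemma conj_weight_quotient:
  fixes y z :: ennreal
  assumes p: "1 < p" and y: "0 < y" and fin: "epow z p * y \<noteq> \<infinity>"
  defines "u \<equiv> epow y (1 - conj_exp p)"
  shows "z = u * (z / u)" and "epow z p * y = u * epow (z / u) p"
proof -
  have q: "1 - conj_exp p < 0" "(1 - conj_exp p) * (1 - p) = 1"
    using p by (simp_all add: conj_exp_def field_simps)
  have "z = u * (z / u) \<and> epow z p * y = u * epow (z / u) p"
  proof (cases "z = 0")
    case True
    then show ?thesis using p by simp
  next
    case False
    then have "epow z p \<noteq> 0"
      using p by (cases z rule: ennreal_zero_pos_top_cases) (auto simp: epow_ennreal)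
    then have "y \<noteq> top" using fin by (auto simp: ennreal_mult_top)
    then obtain a where a: "0 < a" "y = ennreal a"
      using y by (cases y rule: ennreal_zero_pos_top_cases) auto
    have "z \<noteq> top" using fin a p by (auto simp: ennreal_top_mult)
    then obtain b where b: "0 < b" "z = ennreal b"
      using False by (cases z rule: ennreal_zero_pos_top_cases) auto
    define c where "c = a powr (1 - conj_exp p)"
    have c: "0 < c" "u = ennreal c" using a by (simp_all add: c_def u_def epow_ennreal)
    have "c powr (1 - p) = a" using a q by (simp add: c_def powr_powr)
    then have "b powr p * a = c * (b / c) powr p"
      using b c by (auto simp: powr_divide powr_diff)
    then show ?thesis
      using a b c by (simp add: epow_ennreal divide_ennreal flip: ennreal_mult)
  qed
  then show "z = u * (z / u)" and "epow z p * y = u * epow (z / u) p" by auto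
qed

locale power_weight =
  fixes p :: real and v :: "real \<Rightarrow> ennreal"
  assumes p: "1 < p" and v: "v \<in> weights"
    and tail: "0 < x \<Longrightarrow> (\<integral>\<^sup>+t\<in>{x<..}. epow (v t) (1 - conj_exp p) \<partial>lebesgue) < \<infinity>"
begin

definition u :: "real \<Rightarrow> ennreal" where
  "u t = epow (v t) (1 - conj_exp p)"

lemma v_measurable [measurable]: "v \<in> borel_measurable L"
  using v by (simp add: weights_def Mplus_def)

lemma v_pos: "AE t in L. 0 < v t"
  using v by (simp add: weights_def)

lemma u_measurable [measurable]: "u \<in> borel_measurable L"
  unfolding u_def by measurable

sublocale atomless_tail_measure "density L u"
proof
  show "space (density L u) = {0<..}" by (simp add: space_restrict_space)
  show "(\<lambda>t. t) \<in> borel_measurable (density L u)"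
    using id_borel_measurable_lebesgue_on by simp
  fix x :: real
  show "emeasure (density L u) {x<..} < \<infinity>" if x: "0 < x"
  proof -
    have "{x<..} \<in> sets L" using x by (auto simp: sets_restrict_space_iff)
    then show ?thesis using tail[OF x] x
      by (simp add: emeasure_density u_def tail_integral_lebesgue_on)
  qed
  show "emeasure (density L u) {x} = 0"
  proof (cases "0 < x")
    case True
    then have "{x} \<in> null_sets L" by (auto simp: null_sets_restrict_space)
    then show ?thesis using absolutely_continuousI_density[OF u_measurable]
      by (auto simp: absolutely_continuous_def null_sets_def)
  next
    case False
    then have "{x} \<notin> sets (density L u)" by (auto simp: sets_restrict_space_iff)
    then show ?thesis by (rule emeasure_notin_sets)
  qed
qed

lemma nn_integral_u: "f \<in> borel_measurable L \<Longrightarrow> (\<integral>\<^sup>+t. f t \<partial>density L u) = (\<integral>\<^sup>+t. u t * f t \<partial>L)"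
  by (rule nn_integral_density) measurable

text \<open>With \<open>q = p / (p - 1)\<close> one has \<open>(2 p - 1) / (q + 1) = p - 1\<close>.\<close>

lemma Psi_epow:
  assumes "0 < x"
  shows "epow (Psi p v x) (1 - 2 * p) = epow (V x) (1 - p)"
proof -
  have "{x<..} \<in> sets L" using assms by (auto simp: sets_restrict_space_iff)
  then have "V x = (\<integral>\<^sup>+t\<in>{x<..}. epow (v t) (1 - conj_exp p) \<partial>lebesgue)"
    using assms by (simp add: V_eq emeasure_density u_def tail_integral_lebesgue_on)
  moreover have "1 / (conj_exp p + 1) * (1 - 2 * p) = 1 - p"
    using p by (simp add: conj_exp_def field_simps)
  ultimately show ?thesis by (simp add: Psi_def epow_epow)
qed

lemma wnorm_p: "wnorm p v h = epow (\<integral>\<^sup>+t. epow (h t) p * v t \<partial>L) (1 / p)"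
  unfolding wnorm_def by (subst nn_integral_restrict_space) auto

lemma wnorm_1: "wnorm 1 (\<lambda>x. epow (Psi p v x) (1 - 2 * p)) h = (\<integral>\<^sup>+t. h t * epow (V t) (1 - p) \<partial>L)"
  unfolding wnorm_def
  by (subst nn_integral_restrict_space) (auto intro!: nn_integral_cong simp: indicator_def Psi_epow)

text \<open>Finite cost gives \<open>h\<close> a density \<open>r\<close> with respect to \<open>u dx\<close>; \<open>hardy_majorant\<close> applies to \<open>r\<close>, and
  its majorant has the density \<open>k = u H\<close> with respect to \<open>dx\<close>.\<close>

lemma power_of_tail_majorizes_tail:
  assumes h: "h \<in> Mplus" and fin: "(\<integral>\<^sup>+t. epow (h t) p * v t \<partial>L) < \<infinity>"
  obtains k where "k \<in> Mplus"
    and "\<And>x. 0 < x \<Longrightarrow> (\<integral>\<^sup>+t\<in>{x<..}. h t \<partial>lebesgue)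
      \<le> ennreal (2 powr ((2 * p - 1) / p)) * epow (\<integral>\<^sup>+t\<in>{x<..}. k t \<partial>lebesgue) (1 / p)"
    and "(\<integral>\<^sup>+t. k t * epow (V t) (1 - p) \<partial>L) \<le> 2 * (\<integral>\<^sup>+t. epow (h t) p * v t \<partial>L)"
proof -
  have [measurable]: "h \<in> borel_measurable L" using h by (simp add: Mplus_def)
  define r where "r = (\<lambda>t. h t / u t)"
  have [measurable]: "r \<in> borel_measurable L" unfolding r_def by measurable
  have "AE t in L. epow (h t) p * v t \<noteq> \<infinity>"
    using fin by (intro nn_integral_noteq_infinite) auto
  with v_pos have ae: "AE t in L. h t = u t * r t \<and> epow (h t) p * v t = u t * epow (r t) p"
  proof eventually_elim
    case (elim t)
    show ?case
      unfolding r_def u_def using conj_weight_quotient[OF p elim] by blast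
  qed
  have r: "r \<in> borel_measurable (density L u)" by simp
  obtain H where H_density: "H \<in> borel_measurable (density L u)"
    and H: "\<And>x. 0 < x \<Longrightarrow> epow (\<integral>\<^sup>+t\<in>{x<..}. r t \<partial>density L u) p
           \<le> ennreal (2 powr (2 * p - 1)) * (\<integral>\<^sup>+t\<in>{x<..}. H t \<partial>density L u)"
    and H_int: "(\<integral>\<^sup>+t. H t * epow (V t) (1 - p) \<partial>density L u) \<le> 2 * (\<integral>\<^sup>+t. epow (r t) p \<partial>density L u)"
  proof (rule hardy_majorant[OF p r], goal_cases)
    case (1 H)
    then show thesis by (intro that[of H])
  qed
  from H_density have [measurable]: "H \<in> borel_measurable L" by simp
  show thesis
  proof
    show "(\<lambda>t. u t * H t) \<in> Mplus" unfolding Mplus_def by measurable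
    fix x :: real assume x: "0 < x"
    have [measurable]: "{x<..} \<in> sets L" using x by (auto simp: sets_restrict_space_iff)
    have "(\<integral>\<^sup>+t\<in>{x<..}. h t \<partial>lebesgue) = (\<integral>\<^sup>+t\<in>{x<..}. u t * r t \<partial>L)"
      unfolding tail_integral_lebesgue_on[OF less_imp_le[OF x]] using ae
      by (intro nn_integral_cong_AE) auto
    also have "\<dots> = (\<integral>\<^sup>+t\<in>{x<..}. r t \<partial>density L u)"
      by (subst nn_integral_u) (auto simp: mult.assoc)
    finally have h_r: "(\<integral>\<^sup>+t\<in>{x<..}. h t \<partial>lebesgue) = \<dots>" .
    have H_k: "(\<integral>\<^sup>+t\<in>{x<..}. H t \<partial>density L u) = (\<integral>\<^sup>+t\<in>{x<..}. u t * H t \<partial>lebesgue)"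
      unfolding tail_integral_lebesgue_on[OF less_imp_le[OF x]]
      by (subst nn_integral_u) (auto simp: mult.assoc)
    have "(\<integral>\<^sup>+t\<in>{x<..}. h t \<partial>lebesgue) = epow (epow (\<integral>\<^sup>+t\<in>{x<..}. r t \<partial>density L u) p) (1 / p)"
      using p by (simp add: h_r epow_inverse)
    also have "\<dots> \<le> epow (ennreal (2 powr (2 * p - 1)) * (\<integral>\<^sup>+t\<in>{x<..}. u t * H t \<partial>lebesgue)) (1 / p)"
      using p H[OF x] unfolding H_k by (intro epow_mono) auto
    also have "\<dots> = ennreal (2 powr ((2 * p - 1) / p)) * epow (\<integral>\<^sup>+t\<in>{x<..}. u t * H t \<partial>lebesgue) (1 / p)"
      using p by (simp add: epow_mult epow_ennreal powr_powr)
    finally show "(\<integral>\<^sup>+t\<in>{x<..}. h t \<partial>lebesgue) \<le> \<dots>" .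
  next
    have "(\<integral>\<^sup>+t. u t * H t * epow (V t) (1 - p) \<partial>L) = (\<integral>\<^sup>+t. H t * epow (V t) (1 - p) \<partial>density L u)"
      by (subst nn_integral_u) (auto simp: mult.assoc intro!: borel_measurable_times_ennreal measurable_epow_comp measurable_compose[OF id_borel_measurable_lebesgue_on V_borel])
    also note H_int
    also have "(\<integral>\<^sup>+t. epow (r t) p \<partial>density L u) = (\<integral>\<^sup>+t. epow (h t) p * v t \<partial>L)"
      using ae by (subst nn_integral_u) (auto intro!: nn_integral_cong_AE)
    finally show "(\<integral>\<^sup>+t. u t * H t * epow (V t) (1 - p) \<partial>L) \<le> 2 * \<dots>" .
  qed
qed

text \<open>With \<open>A\<close> from \<open>tail_power_majorant\<close>, the function \<open>k = u A\<close> works because \<open>u\<^sup>p v = u\<close>.\<close>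

lemma tail_majorizes_power_of_tail:
  assumes h: "h \<in> Mplus" and fin: "(\<integral>\<^sup>+t. h t * epow (V t) (1 - p) \<partial>L) < \<infinity>"
  obtains k where "k \<in> Mplus"
    and "\<And>x. 0 < x \<Longrightarrow> epow (\<integral>\<^sup>+t\<in>{x<..}. h t \<partial>lebesgue) (1 / p)
      \<le> ennreal (p powr (1 / p)) * (\<integral>\<^sup>+t\<in>{x<..}. k t \<partial>lebesgue)"
    and "(\<integral>\<^sup>+t. epow (k t) p * v t \<partial>L) \<le> (\<integral>\<^sup>+t. h t * epow (V t) (1 - p) \<partial>L)"
proof -
  have hm: "h \<in> borel_measurable L" using h by (simp add: Mplus_def)
  have sp: "space L = {0<..}" by (simp add: space_restrict_space)
  obtain A where A_density: "A \<in> borel_measurable (density L u)"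
    and A: "\<And>x. 0 < x \<Longrightarrow> (\<integral>\<^sup>+y\<in>{x<..}. h y \<partial>L)
           \<le> ennreal p * epow (\<integral>\<^sup>+t\<in>{x<..}. A t \<partial>density L u) p"
    and A_int: "(\<integral>\<^sup>+t. epow (A t) p \<partial>density L u) \<le> (\<integral>\<^sup>+y. h y * epow (V y) (1 - p) \<partial>L)"
  proof (rule tail_power_majorant[OF p sigma_finite_lebesgue_on sp id_borel_measurable_lebesgue_on hm fin], goal_cases)
    case (1 A)
    then show thesis by (intro that[of A])
  qed
  from A_density have [measurable]: "A \<in> borel_measurable L" by simp
  show thesis
  proof
    show "(\<lambda>t. u t * A t) \<in> Mplus" unfolding Mplus_def by measurable
    fix x :: real assume x: "0 < x"
    have [measurable]: "{x<..} \<in> sets L" using x by (auto simp: sets_restrict_space_iff)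
    have "(\<integral>\<^sup>+t\<in>{x<..}. A t \<partial>density L u) = (\<integral>\<^sup>+t\<in>{x<..}. u t * A t \<partial>lebesgue)"
      unfolding tail_integral_lebesgue_on[OF less_imp_le[OF x]]
      by (subst nn_integral_u) (auto simp: mult.assoc)
    with A[OF x] have "(\<integral>\<^sup>+t\<in>{x<..}. h t \<partial>lebesgue)
        \<le> ennreal p * epow (\<integral>\<^sup>+t\<in>{x<..}. u t * A t \<partial>lebesgue) p"
      unfolding tail_integral_lebesgue_on[OF less_imp_le[OF x]] by simp
    then have "epow (\<integral>\<^sup>+t\<in>{x<..}. h t \<partial>lebesgue) (1 / p)
        \<le> epow (ennreal p * epow (\<integral>\<^sup>+t\<in>{x<..}. u t * A t \<partial>lebesgue) p) (1 / p)"
      using p by (intro epow_mono) auto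
    also have "\<dots> = ennreal (p powr (1 / p)) * (\<integral>\<^sup>+t\<in>{x<..}. u t * A t \<partial>lebesgue)"
      using p by (simp add: epow_mult epow_ennreal epow_inverse)
    finally show "epow (\<integral>\<^sup>+t\<in>{x<..}. h t \<partial>lebesgue) (1 / p) \<le> \<dots>" .
  next
    have "AE t in L. epow (u t * A t) p * v t = u t * epow (A t) p"
      using v_pos
    proof eventually_elim
      case (elim t)
      have "epow (u t * A t) p * v t = (epow (u t) p * v t) * epow (A t) p"
        using p by (simp add: epow_mult ac_simps)
      then show ?case using conj_weight_identity[OF p elim] by (simp add: u_def)
    qed
    then have "(\<integral>\<^sup>+t. epow (u t * A t) p * v t \<partial>L) = (\<integral>\<^sup>+t. u t * epow (A t) p \<partial>L)"
      by (rule nn_integral_cong_AE)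
    also have "\<dots> = (\<integral>\<^sup>+t. epow (A t) p \<partial>density L u)" by (subst nn_integral_u) auto
    also note A_int
    finally show "(\<integral>\<^sup>+t. epow (u t * A t) p * v t \<partial>L) \<le> (\<integral>\<^sup>+t. h t * epow (V t) (1 - p) \<partial>L)" .
  qed
qed

end

section \<open>The equivalence\<close>

theorem theorem1p8:
  fixes p :: real
    and T :: "(real \<Rightarrow> ennreal) \<Rightarrow> (real \<Rightarrow> ennreal)"
    and v w :: "real \<Rightarrow> ennreal"
  assumes "1 < p"
    and "monotone_quasilinear T"
    and "w \<in> weights"
    and "v \<in> weights"
    and "\<And>x. 0 < x \<Longrightarrow> (\<integral>\<^sup>+t\<in>{x<..}. epow (v t) (1 - conj_exp p) \<partial>lebesgue) < \<infinity>"
  shows "(\<exists>C>0. \<forall>h\<in>Mplus.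
            wnorm_inf w (T (\<lambda>x. \<integral>\<^sup>+t\<in>{x<..}. h t \<partial>lebesgue))
              \<le> ennreal C * wnorm p v h)
     \<longleftrightarrow> (\<exists>C>0. \<forall>h\<in>Mplus.
            wnorm_inf (\<lambda>x. epow (w x) p)
                (\<lambda>x. epow (T (\<lambda>y. epow (\<integral>\<^sup>+t\<in>{y<..}. h t \<partial>lebesgue) (1 / p)) x) p)
              \<le> ennreal (C powr p) * wnorm 1 (\<lambda>x. epow (Psi p v x) (1 - 2 * p)) h)"
proof -
  interpret power_weight p v using assms(1,4,5) by unfold_locales
  have w: "w \<in> Mplus" using assms(3) by (simp add: weights_def)
  define S :: "(real \<Rightarrow> ennreal) \<Rightarrow> real \<Rightarrow> ennreal" where "S = (\<lambda>h x. \<integral>\<^sup>+t\<in>{x<..}. h t \<partial>lebesgue)"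
  define R where "R = (\<lambda>h x. epow (S h x) (1 / p))"
  define N where "N = (\<lambda>h. \<integral>\<^sup>+t. epow (h t) p * v t \<partial>L)"
  define I where "I = (\<lambda>h. \<integral>\<^sup>+t. h t * epow (V t) (1 - p) \<partial>L)"
  have S_Mplus: "S h \<in> Mplus" and R_Mplus: "R h \<in> Mplus" for h
    unfolding R_def S_def Mplus_def by measurable
  have T_Mplus: "\<And>f. f \<in> Mplus \<Longrightarrow> T f \<in> Mplus"
    using assms(2) unfolding monotone_quasilinear_def by blast
  obtain c where c: "0 < c"
    and dom: "\<And>f g K b. f \<in> Mplus \<Longrightarrow> g \<in> Mplus \<Longrightarrow> 0 \<le> K \<Longrightarrow> (\<And>x. 0 < x \<Longrightarrow> f x \<le> ennreal K * g x)
      \<Longrightarrow> wnorm_inf w (T g) \<le> b \<Longrightarrow> wnorm_inf w (T f) \<le> ennreal (c * K) * b"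
    using monotone_quasilinear_domination[OF assms(2) w] by blast
  \<comment> \<open>The \<open>p\<close>-th root of the second inequality has the same left-hand norm as the first.\<close>
  have unpower: "wnorm_inf (\<lambda>x. epow (w x) p) (\<lambda>x. epow (T (R h) x) p) \<le> ennreal (C powr p) * I h
      \<longleftrightarrow> wnorm_inf w (T (R h)) \<le> ennreal C * epow (I h) (1 / p)" if "0 < C" for C h
  proof -
    have "ennreal (C powr p) * I h = epow (ennreal C * epow (I h) (1 / p)) p"
      using that p by (simp add: epow_mult epow_ennreal epow_inverse)
    then show ?thesis
      using p by (simp add: wnorm_inf_epow_le_iff T_Mplus R_Mplus w)
  qed
  \<comment> \<open>A function of infinite cost satisfies either inequality trivially.\<close>
  have top: "X \<le> ennreal C * epow a (1 / p)" if "0 < C" "\<not> a < \<infinity>" for X C a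
    using that p by (simp add: less_top[symmetric] ennreal_mult_top)
  have "(\<exists>C>0. \<forall>h\<in>Mplus. wnorm_inf w (T (S h)) \<le> ennreal C * epow (N h) (1 / p))
    \<longleftrightarrow> (\<exists>C>0. \<forall>h\<in>Mplus. wnorm_inf w (T (R h)) \<le> ennreal C * epow (I h) (1 / p))"
  proof (intro iffI; elim exE conjE)
    fix C :: real
    assume C: "0 < C" and bound: "\<forall>h\<in>Mplus. wnorm_inf w (T (S h)) \<le> ennreal C * epow (N h) (1 / p)"
    define K where "K = p powr (1 / p)"
    have K: "0 < K" using p by (simp add: K_def)
    have "wnorm_inf w (T (R h)) \<le> ennreal (c * K * C) * epow (I h) (1 / p)" if h: "h \<in> Mplus" for h
    proof (cases "I h < \<infinity>")
      case True
      obtain k where k: "k \<in> Mplus" "\<And>x. 0 < x \<Longrightarrow> R h x \<le> ennreal K * S k x" "N k \<le> I h"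
      proof (rule tail_majorizes_power_of_tail[OF h True[unfolded I_def]], goal_cases)
        case (1 k)
        show thesis
          by (rule that[of k]) (use 1 in \<open>simp_all add: N_def I_def R_def S_def K_def\<close>)
      qed
      have "wnorm_inf w (T (S k)) \<le> ennreal C * epow (N k) (1 / p)" using bound k(1) by blast
      also have "\<dots> \<le> ennreal C * epow (I h) (1 / p)"
        using p k(3) by (intro mult_left_mono epow_mono) auto
      finally have "wnorm_inf w (T (R h)) \<le> ennreal (c * K) * (ennreal C * epow (I h) (1 / p))"
        using K k(2) by (intro dom[of _ "S k"] R_Mplus S_Mplus) auto
      then show ?thesis using c K C by (simp add: ennreal_mult mult.assoc)
    qed (use c K C in \<open>intro top, auto\<close>)
    then show "\<exists>C>0. \<forall>h\<in>Mplus. wnorm_inf w (T (R h)) \<le> ennreal C * epow (I h) (1 / p)"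
      using c K C by (intro exI[of _ "c * K * C"]) auto
  next
    fix C :: real
    assume C: "0 < C" and bound: "\<forall>h\<in>Mplus. wnorm_inf w (T (R h)) \<le> ennreal C * epow (I h) (1 / p)"
    define K where "K = 2 powr ((2 * p - 1) / p)"
    define D where "D = 2 powr (1 / p)"
    have K: "0 < K" and D: "0 < D" by (simp_all add: K_def D_def)
    have "wnorm_inf w (T (S h)) \<le> ennreal (c * K * C * D) * epow (N h) (1 / p)" if h: "h \<in> Mplus" for h
    proof (cases "N h < \<infinity>")
      case True
      obtain k where k: "k \<in> Mplus" "\<And>x. 0 < x \<Longrightarrow> S h x \<le> ennreal K * R k x" "I k \<le> 2 * N h"
      proof (rule power_of_tail_majorizes_tail[OF h True[unfolded N_def]], goal_cases)
        case (1 k)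
        show thesis
          by (rule that[of k]) (use 1 in \<open>simp_all add: N_def I_def R_def S_def K_def\<close>)
      qed
      have "wnorm_inf w (T (R k)) \<le> ennreal C * epow (I k) (1 / p)" using bound k(1) by blast
      also have "\<dots> \<le> ennreal C * epow (ennreal 2 * N h) (1 / p)"
        using p k(3) by (intro mult_left_mono epow_mono) auto
      also have "epow (ennreal 2 * N h) (1 / p) = ennreal D * epow (N h) (1 / p)"
        using p unfolding D_def by (subst epow_mult) (auto simp: epow_ennreal simp del: ennreal_numeral)
      finally have "wnorm_inf w (T (S h)) \<le> ennreal (c * K) * (ennreal C * (ennreal D * epow (N h) (1 / p)))"
        using K k(2) by (intro dom[of _ "R k"] R_Mplus S_Mplus) auto
      then show ?thesis using c K C D by (simp add: ennreal_mult mult.assoc)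
    qed (use c K C D in \<open>intro top, auto\<close>)
    then show "\<exists>C>0. \<forall>h\<in>Mplus. wnorm_inf w (T (S h)) \<le> ennreal C * epow (N h) (1 / p)"
      using c K C D by (intro exI[of _ "c * K * C * D"]) auto
  qed
  then have "(\<exists>C>0. \<forall>h\<in>Mplus. wnorm_inf w (T (S h)) \<le> ennreal C * epow (N h) (1 / p))
    \<longleftrightarrow> (\<exists>C>0. \<forall>h\<in>Mplus. wnorm_inf (\<lambda>x. epow (w x) p) (\<lambda>x. epow (T (R h) x) p) \<le> ennreal (C powr p) * I h)"
    using unpower by (simp cong: conj_cong)
  then show ?thesis unfolding wnorm_p wnorm_1 S_def R_def N_def I_def .
qed

end
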